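(* Let $K$ be a field and let $L$ be a finite pure lattice with no cut edges. Let $I_L \subset K[L]$ be the ideal generated by all basic binomials $ab-(a\wedge b)(a\vee b)$, $a,b\in L$. Then the following conditions are equivalent: (i) $L$ is the divisor lattice of $2\cdot 3^r$ for some $r\ge 1$; (ii) $I_L$ has a quadratic Gröbner basis with respect to any monomial order on $K[L]$.
   Context: For a finite lattice $L$ and a field $K$, $K[L]$ denotes the polynomial ring over $K$ in $|L|$ variables, the variables being the elements of $L$. A binomial of the form $ab-(a\wedge b)(a\vee b)$ with $a,b\in L$ (a polynomial in $K[L]$, where products are products of variables) is called a basic binomial, and $I_L$ is the ideal of $K[L]$ generated by all basic binomials. A finite lattice is pure if all maximal chains between its minimum $\hat 0$ and its maximum $\hat 1$ have the same length. For an element $a$ of a finite pure lattice, $\mathrm{rank}(a)$ is the largest integer $r$ for which there is a chain $\hat 0=a_0<a_1<\cdots<a_r=a$ in $L$. A cut edge of a finite pure lattice $L$ is a pair $(a,b)$ of elements of $L$ with $\mathrm{rank}(b)=\mathrm{rank}(a)+1$ such that $|\{c\in L:\mathrm{rank}(c)=\mathrm{rank}(a)\}|=|\{c\in L:\mathrm{rank}(c)=\mathrm{rank}(b)\}|=1$. The divisor lattice of a positive integer $n$ is the lattice $D_n$ of all divisors of $n$ ordered by divisibility; in (i), "is" means "is isomorphic, as a lattice, to". A quadratic Gröbner basis is a Gröbner basis consisting of polynomials of degree 2. In (ii) the condition is required for every monomial order on $K[L]$. *)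

theory Defs
  imports Complex_Main "HOL-Library.Poly_Mapping"
begin

text \<open>
  A finite lattice is a type of class \<open>{finite, lattice}\<close>. Types are nonempty, so the minimum
  exists and equals the meet of all elements, and every maximal chain runs from the minimum
  to the maximum.
\<close>

text \<open>A chain of \<open>card C\<close> elements has length \<open>card C - 1\<close>.\<close>

definition pure_lattice :: "'a::{finite,lattice} itself \<Rightarrow> bool" where
  "pure_lattice (L :: 'a itself) \<longleftrightarrow>
    (\<forall>(C :: 'a set) (D :: 'a set). pred_on.maxchain UNIV (<) C \<longrightarrow> pred_on.maxchain UNIV (<) D \<longrightarrow>
      card C = card D)"

definition rank :: "'a::{finite,lattice} \<Rightarrow> nat" where
  "rank a = Max {r. \<exists>s :: nat \<Rightarrow> 'a.
      s 0 = Inf_fin UNIV \<and> s r = a \<and> (\<forall>i<r. s i < s (Suc i))}"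

definition cut_edge :: "'a::{finite,lattice} \<Rightarrow> 'a \<Rightarrow> bool" where
  "cut_edge a b \<longleftrightarrow> rank b = rank a + 1 \<and>
     card {c :: 'a. rank c = rank a} = 1 \<and> card {c :: 'a. rank c = rank b} = 1"

text \<open>For \<open>n > 0\<close> the divisors of \<open>n\<close> ordered by divisibility have meet \<open>gcd\<close> and join \<open>lcm\<close>.\<close>

definition iso_divisor_lattice :: "'a::{finite,lattice} itself \<Rightarrow> nat \<Rightarrow> bool" where
  "iso_divisor_lattice (L :: 'a itself) n \<longleftrightarrow>
    (\<exists>f :: 'a \<Rightarrow> nat. bij_betw f UNIV {d. d dvd n} \<and>
      (\<forall>a b. f (inf a b) = gcd (f a) (f b) \<and> f (sup a b) = lcm (f a) (f b)))"

text \<open>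
  Monomials are exponent functions \<open>'a \<Rightarrow>\<^sub>0 nat\<close>, multiplied by adding exponents, with unit \<open>0\<close>.
  The multiplication on \<open>\<Rightarrow>\<^sub>0\<close> is convolution, so \<open>('a \<Rightarrow>\<^sub>0 nat) \<Rightarrow>\<^sub>0 'k\<close> is the polynomial
  ring over \<open>'k\<close> with the elements of \<open>'a\<close> as variables.
\<close>

type_synonym 'a monomial = "'a \<Rightarrow>\<^sub>0 nat"
type_synonym ('a, 'k) mpoly = "('a \<Rightarrow>\<^sub>0 nat) \<Rightarrow>\<^sub>0 'k"

definition mono_poly :: "'a monomial \<Rightarrow> ('a, 'k::field) mpoly" where
  "mono_poly m = Poly_Mapping.single m 1"

definition Var :: "'a \<Rightarrow> ('a, 'k::field) mpoly" where
  "Var a = mono_poly (Poly_Mapping.single a 1)"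

definition total_degree :: "('a, 'k::field) mpoly \<Rightarrow> nat" where
  "total_degree p = Max (insert 0
     ((\<lambda>m. \<Sum>a\<in>Poly_Mapping.keys m. Poly_Mapping.lookup m a) ` Poly_Mapping.keys p))"

definition ideal_gen :: "'r::comm_ring_1 set \<Rightarrow> 'r set" where
  "ideal_gen = module.span (*)"

definition basic_binomial :: "'a::lattice \<Rightarrow> 'a \<Rightarrow> ('a, 'k::field) mpoly" where
  "basic_binomial a b = Var a * Var b - Var (inf a b) * Var (sup a b)"

definition join_meet_ideal :: "('a::{finite,lattice}, 'k::field) mpoly set" where
  "join_meet_ideal = ideal_gen {basic_binomial a b | a b. True}"

text \<open>The argument is the strict order.\<close>

definition monomial_order :: "('a monomial \<Rightarrow> 'a monomial \<Rightarrow> bool) \<Rightarrow> bool" where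
  "monomial_order lt \<longleftrightarrow> irreflp lt \<and> transp lt \<and> totalp lt \<and>
     (\<forall>u. u \<noteq> 0 \<longrightarrow> lt 0 u) \<and> (\<forall>u v w. lt u v \<longrightarrow> lt (u + w) (v + w))"

text \<open>Meaningful for \<open>p \<noteq> 0\<close> only.\<close>

definition initial_monomial ::
    "('a monomial \<Rightarrow> 'a monomial \<Rightarrow> bool) \<Rightarrow> ('a, 'k::field) mpoly \<Rightarrow> 'a monomial" where
  "initial_monomial lt p = (THE m. m \<in> Poly_Mapping.keys p \<and>
     (\<forall>m'\<in>Poly_Mapping.keys p. m' \<noteq> m \<longrightarrow> lt m' m))"

definition initial_ideal ::
    "('a monomial \<Rightarrow> 'a monomial \<Rightarrow> bool) \<Rightarrow> ('a, 'k::field) mpoly set \<Rightarrow> ('a, 'k) mpoly set" where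
  "initial_ideal lt I = ideal_gen {mono_poly (initial_monomial lt f) | f. f \<in> I \<and> f \<noteq> 0}"

text \<open>
  Convention: Groebner bases are defined for nonzero ideals only. This matters for the
  one-element lattice, whose ideal is zero: the empty set is not counted as a (vacuously
  quadratic) Groebner basis of it.
\<close>

definition groebner_basis ::
    "('a monomial \<Rightarrow> 'a monomial \<Rightarrow> bool) \<Rightarrow> ('a, 'k::field) mpoly set \<Rightarrow> ('a, 'k) mpoly set \<Rightarrow> bool"
  where
  "groebner_basis lt G I \<longleftrightarrow> I \<noteq> {0} \<and> finite G \<and> G \<subseteq> I \<and> 0 \<notin> G \<and>
     initial_ideal lt I = ideal_gen {mono_poly (initial_monomial lt g) | g. g \<in> G}"

definition quadratic_groebner_basis ::
    "('a monomial \<Rightarrow> 'a monomial \<Rightarrow> bool) \<Rightarrow> ('a, 'k::field) mpoly set \<Rightarrow> ('a, 'k) mpoly set \<Rightarrow> bool"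
  where
  "quadratic_groebner_basis lt G I \<longleftrightarrow>
     groebner_basis lt G I \<and> (\<forall>g\<in>G. total_degree g = 2)"

end

theory Submission
  imports Defs "HOL-Computational_Algebra.Primes"
begin

text \<open>
  Both directions rest on one observation. Call a set of monomials saturated if the exchanges
  \<open>a b t \<leftrightarrow> (a \<sqinter> b) (a \<squnion> b) t\<close> do not lead out of it. The coefficients of an element of the
  join-meet ideal over a saturated set sum to zero (\<open>class_sum_join_meet_ideal\<close>), so no monomial
  of such an element is alone in its class. Consequently a monomial is an initial monomial of
  the ideal only if its class contains a smaller monomial.

  From (i) to (ii). The lattice of divisors of \<open>2 * 3 ^ r\<close> is the product of a chain of two and a
  chain of \<open>r + 1\<close> elements, and the basic binomials are the \<open>2\<close>-minors of a generic matrix with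
  two rows. A monomial is a table of exponents with two rows, and exchanges preserve the row and
  column sums. If two tables with equal margins differ, then one of them exceeds the other at
  opposite corners of some minor; moving such corners step by step shows, for every order, that
  a monomial that is not the smallest one with its margins is divisible by the initial monomial of a
  minor (\<open>minor_divides_larger_monomial\<close>). So the minors are a universal Groebner basis.

  From (ii) to (i). In degree 2 the class of \<open>s t\<close> consists of all \<open>u v\<close> with the same meet and
  join. If for some order and distinct \<open>x\<close>, \<open>y\<close>, \<open>z\<close> the monomial \<open>x y z\<close> is not minimal in its
  class, but each of \<open>x y\<close>, \<open>x z\<close> and \<open>y z\<close> is minimal in its own, then no quadric of the ideal
  has an initial monomial dividing \<open>x y z\<close>, and there is no
  quadratic Groebner basis. With orders refining suitable weights (\<open>light_triple_is_minimal\<close>)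
  this excludes four configurations:

  \<^item> two different relative complements \<open>a\<close>, \<open>b\<close> of an element in an interval (\<open>cancel\<close>);
    hence the lattice is modular;
  \<^item> two squares, the top of one being the bottom of the other (\<open>no_stacked_squares\<close>);
  \<^item> a cube (\<open>no_cube\<close>), so that no element has three covers (\<open>at_most_two_covers\<close>);
  \<^item> a grid of three by three elements (\<open>no_grid\<close>).

  Now climb the lattice from its minimum; it has more than one element, as the zero ideal has no
  Groebner basis. Without cut edges there are two atoms, and excluding
  the grid makes one of them, \<open>b\<close>, have their join as its only cover. Let a rank consist of
  two elements \<open>p\<close> and \<open>q\<close>, where only \<open>p \<squnion> q\<close> covers \<open>q\<close>. The next rank contains \<open>p \<squnion> q\<close> and at
  most one further element \<open>s\<close>, which covers \<open>p\<close>. If \<open>s\<close> exists then, by the exclusion of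
  stacked squares, \<open>p \<squnion> q\<close> has only one cover, and the situation repeats one rank higher; if not,
  then \<open>p \<squnion> q\<close> is the maximum, since otherwise it would have a single cover, forming a cut edge
  with it (\<open>ladder_extend\<close>). The chain of the elements \<open>p\<close> and its joins with \<open>b\<close> are the
  two rows.
\<close>

section \<open>Ideals of polynomials and saturated sets of monomials\<close>

interpretation ring_module: module "(*) :: 'r::comm_ring_1 \<Rightarrow> 'r \<Rightarrow> 'r"
  by unfold_locales (simp_all add: algebra_simps)

lemma mpoly_eq_sum_single:
  "p = (\<Sum>t\<in>Poly_Mapping.keys p. Poly_Mapping.single t (Poly_Mapping.lookup p t))"
  by (rule poly_mapping_eqI)
    (auto simp: lookup_sum lookup_single when_def not_in_keys_iff_lookup_eq_zero)

text \<open>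
  By additivity, multiplying a generator by a polynomial reduces to multiplying it by single
  terms.
\<close>

lemma ideal_gen_induct [consumes 1, case_names zero add single]:
  fixes f :: "('a, 'k::field) mpoly"
  assumes "f \<in> ideal_gen S"
    and zero: "P 0"
    and add: "\<And>f g. P f \<Longrightarrow> P g \<Longrightarrow> P (f + g)"
    and single: "\<And>t c s. s \<in> S \<Longrightarrow> P (Poly_Mapping.single t c * s)"
  shows "P f"
  using assms(1) unfolding ideal_gen_def
proof (induction rule: ring_module.span_induct_alt)
  case base
  show ?case by (rule zero)
next
  case (step r s f)
  have "P (\<Sum>t\<in>T. Poly_Mapping.single t (Poly_Mapping.lookup r t) * s)" if "finite T" for T
    using that by (induction) (simp_all add: zero add single step.hyps)
  from this[of "Poly_Mapping.keys r"] have "P (r * s)"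
    by (simp flip: sum_distrib_right mpoly_eq_sum_single)
  then show ?case using step by (simp add: add)
qed

definition class_sum :: "'a monomial set \<Rightarrow> ('a, 'k::field) mpoly \<Rightarrow> 'k" where
  "class_sum C f = (\<Sum>m\<in>Poly_Mapping.keys f. (Poly_Mapping.lookup f m when m \<in> C))"

lemma class_sum_superset:
  assumes "finite K" "Poly_Mapping.keys f \<subseteq> K"
  shows "class_sum C f = (\<Sum>m\<in>K. (Poly_Mapping.lookup f m when m \<in> C))"
  unfolding class_sum_def using assms
  by (intro sum.mono_neutral_left) (auto simp: in_keys_iff)

lemma class_sum_zero: "class_sum C 0 = 0"
  by (simp add: class_sum_def)

lemma class_sum_add: "class_sum C (f + g) = class_sum C f + class_sum C g"
proof -
  let ?K = "Poly_Mapping.keys f \<union> Poly_Mapping.keys g"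
  have "class_sum C h = (\<Sum>m\<in>?K. (Poly_Mapping.lookup h m when m \<in> C))"
    if "Poly_Mapping.keys h \<subseteq> ?K" for h
    using that by (intro class_sum_superset) auto
  from this[OF keys_add] this[of f] this[of g] show ?thesis
    by (simp add: lookup_add when_add_distrib sum.distrib)
qed

lemma class_sum_single: "class_sum C (Poly_Mapping.single m c) = (c when m \<in> C)"
  by (simp add: class_sum_def)

lemma class_sum_uminus: "class_sum C (- f) = - class_sum C f"
  using class_sum_add[of C f "- f"] by (simp add: class_sum_zero eq_neg_iff_add_eq_0 add.commute)

lemma class_sum_diff: "class_sum C (f - g) = class_sum C f - class_sum C g"
  using class_sum_add[of C f "- g"] by (simp add: class_sum_uminus)

abbreviation var :: "'a \<Rightarrow> 'a monomial" where
  "var a \<equiv> Poly_Mapping.single a 1"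

lemma basic_binomial_eq:
  "(basic_binomial a b :: ('a::lattice, 'k::field) mpoly) =
     Poly_Mapping.single (var a + var b) 1 - Poly_Mapping.single (var (inf a b) + var (sup a b)) 1"
  by (simp add: basic_binomial_def Var_def mono_poly_def mult_single)

text \<open>
  The unions of classes of the congruence on monomials generated by the basic binomials.
\<close>

definition saturated :: "'a::lattice monomial set \<Rightarrow> bool" where
  "saturated C \<longleftrightarrow> (\<forall>a b t. var a + var b + t \<in> C \<longleftrightarrow> var (inf a b) + var (sup a b) + t \<in> C)"

text \<open>
  A monomial multiple of a basic binomial is the difference of two monomials which a saturated
  set either both contains or both omits, so its coefficients over the set cancel; such multiples
  span the ideal.
\<close>

lemma class_sum_join_meet_ideal:
  fixes f :: "('a::{finite,lattice}, 'k::field) mpoly"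
  assumes "saturated C" and "f \<in> join_meet_ideal"
  shows "class_sum C f = 0"
  using assms(2) unfolding join_meet_ideal_def
proof (induction rule: ideal_gen_induct)
  case (single t c s)
  then obtain a b where s: "s = basic_binomial a b" by blast
  show ?case
    using assms(1) unfolding saturated_def s basic_binomial_eq
    by (simp add: algebra_simps mult_single class_sum_diff class_sum_single add.left_commute)
qed (simp_all add: class_sum_zero class_sum_add)

text \<open>
  A lone nonzero coefficient over \<open>C\<close> could not sum to zero. If \<open>m\<close> is the initial monomial of
  \<open>f\<close>, the result is a smaller monomial in \<open>C\<close>.
\<close>

lemma saturated_mem_not_alone:
  fixes f :: "('a::{finite,lattice}, 'k::field) mpoly"
  assumes "saturated C" "f \<in> join_meet_ideal" "m \<in> C" "m \<in> Poly_Mapping.keys f"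
  obtains m' where "m' \<in> C" "m' \<in> Poly_Mapping.keys f" "m' \<noteq> m"
proof (rule ccontr)
  assume "\<not> thesis"
  with that have "m' = m" if "m' \<in> C" "m' \<in> Poly_Mapping.keys f" for m' using that by blast
  then have "class_sum C f =
      (\<Sum>m'\<in>Poly_Mapping.keys f. (Poly_Mapping.lookup f m' when m' = m))"
    unfolding class_sum_def using assms(3) by (intro sum.cong) (auto simp: when_def)
  also have "\<dots> = Poly_Mapping.lookup f m"
    using assms(4) by (simp add: when_def)
  finally show False
    using class_sum_join_meet_ideal[OF assms(1,2)] assms(4) by (simp add: in_keys_iff)
qed

section \<open>Monomial ideals and initial monomials\<close>

text \<open>
  Divisibility by some monomial of \<open>M\<close> holds for every monomial occurring in an element of the
  ideal, because products and sums preserve it.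
\<close>

lemma mono_poly_in_monomial_ideal:
  fixes m :: "'a monomial"
  assumes "(mono_poly m :: ('a, 'k::field) mpoly) \<in> ideal_gen (mono_poly ` M)"
  shows "\<exists>n\<in>M. \<exists>t. m = n + t"
proof -
  have "\<forall>m\<in>Poly_Mapping.keys f. \<exists>n\<in>M. \<exists>t. m = n + t"
    if "f \<in> ideal_gen (mono_poly ` M)" for f :: "('a, 'k) mpoly"
    using that
  proof (induction rule: ideal_gen_induct)
    case (add f g)
    then show ?case using keys_add[of f g] by blast
  next
    case (single t c s)
    then show ?case by (auto simp: mono_poly_def mult_single split: if_splits) (metis add.commute)
  qed simp
  from this[OF assms] show ?thesis by (simp add: mono_poly_def)
qed

context
  fixes lt :: "'a monomial \<Rightarrow> 'a monomial \<Rightarrow> bool"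
  assumes lt: "monomial_order lt"
begin

lemma lt_irrefl: "\<not> lt m m"
  using lt by (auto simp: monomial_order_def irreflp_def)

lemma lt_trans: "lt u v \<Longrightarrow> lt v w \<Longrightarrow> lt u w"
  using lt unfolding monomial_order_def by (meson transpD)

lemma lt_total: "u \<noteq> v \<Longrightarrow> lt u v \<or> lt v u"
  using lt unfolding monomial_order_def by (metis UNIV_I totalp_onD)

lemma lt_add: "lt u v \<Longrightarrow> lt (u + w) (v + w)"
  using lt unfolding monomial_order_def by blast

text \<open>
  Only finitely many monomials occur in \<open>p\<close>, so the total order has a greatest one among them.
\<close>

lemma initial_monomial_props:
  fixes p :: "('a, 'k::field) mpoly"
  assumes "p \<noteq> 0"
  shows initial_monomial_in_keys: "initial_monomial lt p \<in> Poly_Mapping.keys p"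
    and lt_initial_monomial:
      "m \<in> Poly_Mapping.keys p \<Longrightarrow> m \<noteq> initial_monomial lt p \<Longrightarrow> lt m (initial_monomial lt p)"
proof -
  let ?top = "\<lambda>K m. m \<in> K \<and> (\<forall>m'\<in>K. m' \<noteq> m \<longrightarrow> lt m' m)"
  have "\<exists>m. ?top K m" if "finite K" "K \<noteq> {}" for K
    using that
  proof (induction rule: finite_ne_induct)
    case (insert x K)
    then obtain m where "?top K m" by blast
    show ?case
    proof (cases "lt x m")
      case True
      then show ?thesis using \<open>?top K m\<close> by (intro exI[of _ m]) auto
    next
      case False
      then have "x = m \<or> lt m x" using lt_total by blast
      then have "\<forall>m'\<in>K. m' \<noteq> x \<longrightarrow> lt m' x" using \<open>?top K m\<close> lt_trans by metis
      then show ?thesis by blast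
    qed
  qed auto
  from this[of "Poly_Mapping.keys p"] obtain m where m: "?top (Poly_Mapping.keys p) m"
    using assms by (auto simp: poly_mapping_eq_iff fun_eq_iff in_keys_iff)
  have "\<exists>!m. ?top (Poly_Mapping.keys p) m"
    using m by (intro ex1I[of _ m]) (metis lt_trans lt_irrefl)+
  from theI'[OF this] show "initial_monomial lt p \<in> Poly_Mapping.keys p"
    and "m \<in> Poly_Mapping.keys p \<Longrightarrow> m \<noteq> initial_monomial lt p \<Longrightarrow> lt m (initial_monomial lt p)"
    for m
    unfolding initial_monomial_def by blast+
qed

lemma initial_monomial_diff:
  assumes "lt v u"
  shows "initial_monomial lt (mono_poly u - mono_poly v :: ('a, 'k::field) mpoly) = u"
    and "(mono_poly u - mono_poly v :: ('a, 'k::field) mpoly) \<noteq> 0"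
proof -
  let ?p = "mono_poly u - mono_poly v :: ('a, 'k::field) mpoly"
  have ne: "u \<noteq> v" using assms lt_irrefl by blast
  have keys: "Poly_Mapping.keys ?p = {u, v}"
    using ne by (auto simp: mono_poly_def in_keys_iff lookup_minus lookup_single when_def split: if_splits)
  then show nz: "?p \<noteq> 0" by auto
  show "initial_monomial lt ?p = u"
  proof (rule ccontr)
    assume neq: "initial_monomial lt ?p \<noteq> u"
    then have "initial_monomial lt ?p = v" "lt u (initial_monomial lt ?p)"
      using initial_monomial_in_keys[OF nz] lt_initial_monomial[OF nz, of u] keys by auto
    then show False using assms lt_trans[of u v u] lt_irrefl by simp
  qed
qed

end

section \<open>Monomial orders refining weights\<close>

text \<open>
  Monomials are compared at the first index where the functions differ. Additivity makes the
  comparison invariant under multiplication and gives the monomial 1 the value 0 everywhere, so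
  that nothing lies below it.
\<close>

lemma lexicographic_monomial_order:
  fixes \<phi> :: "nat \<Rightarrow> 'a monomial \<Rightarrow> nat"
  assumes additive: "\<And>k u v. \<phi> k (u + v) = \<phi> k u + \<phi> k v"
    and separating: "\<And>u v. (\<And>k. \<phi> k u = \<phi> k v) \<Longrightarrow> u = v"
  shows "monomial_order (\<lambda>u v. \<exists>k. (\<forall>i<k. \<phi> i u = \<phi> i v) \<and> \<phi> k u < \<phi> k v)" (is "monomial_order ?lt")
proof -
  have zero: "\<phi> k 0 = 0" for k using additive[of k 0 0] by simp
  have total: "?lt u v \<or> ?lt v u" if "u \<noteq> v" for u v
  proof -
    have "\<exists>k. \<phi> k u \<noteq> \<phi> k v" using separating that by blast
    then obtain k where "\<phi> k u \<noteq> \<phi> k v" "\<forall>i<k. \<phi> i u = \<phi> i v"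
      using exists_least_iff[of "\<lambda>k. \<phi> k u \<noteq> \<phi> k v"] by auto
    then show ?thesis by (metis linorder_neqE_nat)
  qed
  have "?lt u w" if "?lt u v" "?lt v w" for u v w
  proof -
    from that obtain k l where kl: "\<forall>i<k. \<phi> i u = \<phi> i v" "\<phi> k u < \<phi> k v"
      "\<forall>i<l. \<phi> i v = \<phi> i w" "\<phi> l v < \<phi> l w" by blast
    have "\<phi> (min k l) u < \<phi> (min k l) w"
      using kl by (cases k l rule: linorder_cases) (auto simp: min_def)
    with kl show ?thesis by (intro exI[of _ "min k l"]) auto
  qed
  moreover have "?lt 0 u" if "u \<noteq> 0" for u using total[of 0 u] that by (auto simp: zero)
  ultimately show ?thesis
    unfolding monomial_order_def irreflp_def transp_def totalp_on_def
    using total by (auto simp: additive)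
qed

definition weight :: "('a::finite \<Rightarrow> nat) \<Rightarrow> 'a monomial \<Rightarrow> nat" where
  "weight w m = (\<Sum>a\<in>UNIV. w a * Poly_Mapping.lookup m a)"

lemma weight_add: "weight w (u + v) = weight w u + weight w v"
  by (simp add: weight_def lookup_add algebra_simps sum.distrib)

lemma weight_zero [simp]: "weight w 0 = 0"
  by (simp add: weight_def)

lemma weight_var [simp]: "weight w (Poly_Mapping.single a (Suc 0)) = w a"
  by (simp add: weight_def lookup_single when_def if_distrib cong: if_cong)

text \<open>
  Ties of the weight are broken by the exponents along an enumeration of the variables.
\<close>

lemma weight_refining_order:
  fixes w :: "'a::finite \<Rightarrow> nat"
  obtains lt where "monomial_order lt" "\<And>u v. weight w u < weight w v \<Longrightarrow> lt u v"
proof -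
  obtain g :: "nat \<Rightarrow> 'a" and n where "g ` {i. i < n} = UNIV"
    using finite_imp_nat_seg_image_inj_on[of "UNIV :: 'a set"] by auto
  then have h: "range g = UNIV" by blast
  let ?\<phi> = "\<lambda>k m. case k of 0 \<Rightarrow> weight w m | Suc i \<Rightarrow> Poly_Mapping.lookup m (g i)"
  have "monomial_order (\<lambda>u v. \<exists>k. (\<forall>i<k. ?\<phi> i u = ?\<phi> i v) \<and> ?\<phi> k u < ?\<phi> k v)"
  proof (rule lexicographic_monomial_order)
    show "?\<phi> k (u + v) = ?\<phi> k u + ?\<phi> k v" for k u v
      by (simp add: weight_add lookup_add split: nat.split)
    show "u = v" if eq: "\<And>k. ?\<phi> k u = ?\<phi> k v" for u v
    proof (rule poly_mapping_eqI)
      fix a obtain i where "a = g i" using h by blast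
      then show "Poly_Mapping.lookup u a = Poly_Mapping.lookup v a" using eq[of "Suc i"] by simp
    qed
  qed
  then show thesis
    by (rule that) (rule exI[of _ 0], simp)
qed

abbreviation deg :: "'a::finite monomial \<Rightarrow> nat" where
  "deg \<equiv> weight (\<lambda>_. 1)"

lemma basic_binomial_in_ideal: "basic_binomial a b \<in> join_meet_ideal"
  unfolding join_meet_ideal_def ideal_gen_def by (rule ring_module.span_base) blast

lemma initial_monomial_uminus: "initial_monomial lt (- p) = initial_monomial lt p"
proof -
  have "Poly_Mapping.keys (- p) = Poly_Mapping.keys p" by (auto simp: in_keys_iff)
  then show ?thesis unfolding initial_monomial_def by simp
qed

lemma total_degree_homogeneous:
  fixes p :: "('a::finite, 'k::field) mpoly"
  assumes "p \<noteq> 0" "\<And>m. m \<in> Poly_Mapping.keys p \<Longrightarrow> deg m = d"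
  shows "total_degree p = d"
proof -
  have "(\<Sum>a\<in>Poly_Mapping.keys m. Poly_Mapping.lookup m a) = deg m" for m :: "'a monomial"
    unfolding weight_def by (rule sum.mono_neutral_cong_left) (auto simp: in_keys_iff)
  moreover have "Poly_Mapping.keys p \<noteq> {}"
    using assms(1) by (auto simp: poly_mapping_eq_iff fun_eq_iff in_keys_iff)
  ultimately have "((\<lambda>m. \<Sum>a\<in>Poly_Mapping.keys m. Poly_Mapping.lookup m a) ` Poly_Mapping.keys p) = {d}"
    using assms(2) by (auto simp: image_constant_conv)
  then show ?thesis unfolding total_degree_def by simp
qed

lemma total_degree_basic_binomial:
  fixes a b :: "'a::{finite,lattice}"
  assumes "(basic_binomial a b :: ('a, 'k::field) mpoly) \<noteq> 0"
  shows "total_degree (basic_binomial a b :: ('a, 'k) mpoly) = 2"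
  using assms
proof (rule total_degree_homogeneous)
  fix m assume "m \<in> Poly_Mapping.keys (basic_binomial a b :: ('a, 'k) mpoly)"
  then have "m = var a + var b \<or> m = var (inf a b) + var (sup a b)"
    by (auto simp: basic_binomial_eq in_keys_iff lookup_minus lookup_single when_def split: if_splits)
  then show "deg m = 2" by (auto simp: weight_add)
qed

section \<open>The lattice of two rows\<close>

text \<open>
  The product of a chain of two elements and the chain \<open>{0..r}\<close>, with lower row \<open>p\<close> and upper
  row \<open>q\<close>. Monotonicity already determines the meets and joins inside a row.
\<close>

locale two_row_lattice =
  fixes r :: nat and p q :: "nat \<Rightarrow> 'a::{finite,lattice}"
  assumes cover: "\<And>x. (\<exists>i\<le>r. x = p i) \<or> (\<exists>i\<le>r. x = q i)"
    and inj_p: "inj_on p {..r}" and inj_q: "inj_on q {..r}"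
    and p_neq_q: "\<And>i j. i \<le> r \<Longrightarrow> j \<le> r \<Longrightarrow> p i \<noteq> q j"
    and p_mono: "\<And>i j. i \<le> j \<Longrightarrow> j \<le> r \<Longrightarrow> p i \<le> p j"
    and q_mono: "\<And>i j. i \<le> j \<Longrightarrow> j \<le> r \<Longrightarrow> q i \<le> q j"
    and inf_pq: "\<And>i j. i \<le> r \<Longrightarrow> j \<le> r \<Longrightarrow> inf (p i) (q j) = p (min i j)"
    and sup_pq: "\<And>i j. i \<le> r \<Longrightarrow> j \<le> r \<Longrightarrow> sup (p i) (q j) = q (max i j)"
begin

text \<open>
  The exponents of a monomial form a contingency table with two rows, and its margins are
  what the exchanges preserve. The sum of row \<open>q\<close> is determined by the other margins.
\<close>

definition same_margins :: "'a monomial \<Rightarrow> 'a monomial \<Rightarrow> bool" where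
  "same_margins u v \<longleftrightarrow>
    (\<forall>i\<le>r. Poly_Mapping.lookup u (p i) + Poly_Mapping.lookup u (q i) =
            Poly_Mapping.lookup v (p i) + Poly_Mapping.lookup v (q i)) \<and>
    (\<Sum>i\<le>r. Poly_Mapping.lookup u (p i)) = (\<Sum>i\<le>r. Poly_Mapping.lookup v (p i))"

lemma same_margins_sym: "same_margins u v \<Longrightarrow> same_margins v u"
  and same_margins_trans: "same_margins u v \<Longrightarrow> same_margins v w \<Longrightarrow> same_margins u w"
  and same_margins_add: "same_margins u v \<Longrightarrow> same_margins (u + t) (v + t)"
  unfolding same_margins_def
  by (auto simp: lookup_add sum.distrib algebra_simps)

lemma p_eq_iff: "i \<le> r \<Longrightarrow> j \<le> r \<Longrightarrow> p i = p j \<longleftrightarrow> i = j"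
  and q_eq_iff: "i \<le> r \<Longrightarrow> j \<le> r \<Longrightarrow> q i = q j \<longleftrightarrow> i = j"
  using inj_p inj_q by (auto simp: inj_on_eq_iff)

lemma same_margins_swap:
  assumes "i \<le> r" "j \<le> r"
  shows "same_margins (var (p i) + var (q j)) (var (p j) + var (q i))"
  using assms unfolding same_margins_def
  by (auto simp: lookup_add lookup_single when_def p_eq_iff q_eq_iff p_neq_q p_neq_q[symmetric] sum.distrib
      cong: if_cong)

text \<open>
  For comparable \<open>a\<close> and \<open>b\<close> both products coincide; otherwise they are the two diagonals
  of a minor.
\<close>

lemma same_margins_basic: "same_margins (var a + var b) (var (inf a b) + var (sup a b))"
proof -
  have refl: "same_margins u u" for u by (simp add: same_margins_def)
  have comparable: ?thesis if "a \<le> b \<or> b \<le> a"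
    using that refl[of "var a + var b"]
    by (auto simp: inf_absorb1 inf_absorb2 sup_absorb1 sup_absorb2 add.commute)
  have mixed: "same_margins (var (p i) + var (q j)) (var (inf (p i) (q j)) + var (sup (p i) (q j)))"
    if "i \<le> r" "j \<le> r" for i j
    using that refl same_margins_swap[of i j]
    by (cases "i \<le> j") (auto simp: inf_pq sup_pq min_def max_def)
  consider "a \<le> b \<or> b \<le> a" | i j where "i \<le> r" "j \<le> r" "a = p i" "b = q j"
    | i j where "i \<le> r" "j \<le> r" "b = p i" "a = q j"
    using cover[of a] cover[of b] p_mono q_mono by (metis nle_le)
  then show ?thesis
  proof cases
    case 3
    then show ?thesis using mixed[of i j] by (simp add: add.commute inf_commute sup_commute)
  qed (use comparable mixed in auto)
qed

lemma saturated_same_margins: "saturated {v. same_margins u v}"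
  unfolding saturated_def
  using same_margins_add[OF same_margins_basic] same_margins_trans same_margins_sym by (metis mem_Collect_eq)

text \<open>
  As the sums of row \<open>p\<close> agree, \<open>u\<close> exceeds \<open>v\<close> in some column of it and falls short in
  another; the column sums reverse this in row \<open>q\<close>.
\<close>

lemma same_margins_exchange:
  assumes "same_margins u v" "u \<noteq> v"
  obtains i j u' v' where "i \<le> r" "j \<le> r"
    "Poly_Mapping.lookup v (p i) < Poly_Mapping.lookup u (p i)"
    "Poly_Mapping.lookup u (p j) < Poly_Mapping.lookup v (p j)"
    "u = var (p i) + var (q j) + u'" "v = var (p j) + var (q i) + v'"
proof -
  have split: "\<exists>w'. w = var x + var y + w'"
    if "x \<noteq> y" "Poly_Mapping.lookup w x > 0" "Poly_Mapping.lookup w y > 0" for w x and y :: 'a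
    using that by (intro exI[of _ "w - var x - var y"] poly_mapping_eqI)
      (auto simp: lookup_add lookup_minus lookup_single when_def)
  have col: "Poly_Mapping.lookup u (p i) + Poly_Mapping.lookup u (q i) =
      Poly_Mapping.lookup v (p i) + Poly_Mapping.lookup v (q i)" if "i \<le> r" for i
    using assms(1) that by (simp add: same_margins_def)
  have row: "(\<Sum>i\<le>r. Poly_Mapping.lookup u (p i)) = (\<Sum>i\<le>r. Poly_Mapping.lookup v (p i))"
    using assms(1) by (simp add: same_margins_def)
  have "\<exists>i\<le>r. Poly_Mapping.lookup u (p i) \<noteq> Poly_Mapping.lookup v (p i)"
  proof (rule ccontr)
    assume "\<not> ?thesis"
    then have "Poly_Mapping.lookup u x = Poly_Mapping.lookup v x" for x
      using cover[of x] col by (metis add_left_imp_eq)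
    with assms(2) show False by (auto intro: poly_mapping_eqI)
  qed
  then obtain k where k: "k \<le> r" "Poly_Mapping.lookup u (p k) \<noteq> Poly_Mapping.lookup v (p k)" by blast
  have "\<exists>i\<le>r. Poly_Mapping.lookup u (p i) > Poly_Mapping.lookup v (p i)"
  proof (rule ccontr)
    assume "\<not> ?thesis"
    then have "(\<Sum>i\<le>r. Poly_Mapping.lookup u (p i)) < (\<Sum>i\<le>r. Poly_Mapping.lookup v (p i))"
      using k k(2)[symmetric]
      by (intro sum_strict_mono_ex1 bexI[of _ k] ballI) (auto simp: not_less intro!: le_neq_implies_less)
    with row show False by simp
  qed
  moreover have "\<exists>i\<le>r. Poly_Mapping.lookup u (p i) < Poly_Mapping.lookup v (p i)"
  proof (rule ccontr)
    assume "\<not> ?thesis"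
    then have "(\<Sum>i\<le>r. Poly_Mapping.lookup v (p i)) < (\<Sum>i\<le>r. Poly_Mapping.lookup u (p i))"
      using k k(2)[symmetric]
      by (intro sum_strict_mono_ex1 bexI[of _ k] ballI) (auto simp: not_less intro!: le_neq_implies_less)
    with row show False by simp
  qed
  ultimately obtain i j where ij: "i \<le> r" "j \<le> r"
    "Poly_Mapping.lookup u (p i) > Poly_Mapping.lookup v (p i)"
    "Poly_Mapping.lookup u (p j) < Poly_Mapping.lookup v (p j)" by blast
  have "\<exists>u'. u = var (p i) + var (q j) + u'"
    using ij col[of j] by (intro split) (auto simp: p_neq_q)
  moreover have "\<exists>v'. v = var (p j) + var (q i) + v'"
    using ij col[of i] by (intro split) (auto simp: p_neq_q)
  ultimately show thesis using that ij by blast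
qed

text \<open>
  The two diagonals of a minor differ by a basic binomial up to sign; the larger column index
  belongs to the incomparable diagonal in row \<open>p\<close>.
\<close>

lemma swap_binomial_basic:
  fixes i j
  defines "g \<equiv> mono_poly (var (p i) + var (q j)) - mono_poly (var (p j) + var (q i)) :: ('a, 'k::field) mpoly"
  assumes "i \<le> r" "j \<le> r"
  shows "g = basic_binomial (p i) (q j) \<or> - g = basic_binomial (p j) (q i)"
  using assms by (cases "i \<le> j") (auto simp: basic_binomial_eq mono_poly_def inf_pq sup_pq min_def max_def)

text \<open>
  Take a minor whose diagonal \<open>p i, q j\<close> divides \<open>u\<close> and whose other diagonal divides \<open>v\<close>.
  If the diagonal dividing \<open>u\<close> is the smaller one, substituting it into \<open>v\<close> gives a
  still smaller monomial with the same margins, nearer to \<open>u\<close>; so the search ends with a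
  minor of the other kind.
\<close>

lemma minor_divides_larger_monomial:
  assumes lt: "monomial_order lt" and "same_margins u v" "lt v u"
  shows "\<exists>i j t. i \<le> r \<and> j \<le> r \<and> u = var (p i) + var (q j) + t \<and>
    lt (var (p j) + var (q i)) (var (p i) + var (q j))"
  using assms(2,3)
proof (induction "\<Sum>k\<le>r. Poly_Mapping.lookup v (p k) - Poly_Mapping.lookup u (p k)"
    arbitrary: v rule: less_induct)
  case less
  have "u \<noteq> v" using less.prems lt_irrefl[OF lt] by auto
  with less.prems obtain i j u' v' where ij: "i \<le> r" "j \<le> r"
    and less_i: "Poly_Mapping.lookup v (p i) < Poly_Mapping.lookup u (p i)"
    and less_j: "Poly_Mapping.lookup u (p j) < Poly_Mapping.lookup v (p j)"
    and u: "u = var (p i) + var (q j) + u'" and v: "v = var (p j) + var (q i) + v'"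
    by (elim same_margins_exchange)
  have "i \<noteq> j" using less_i less_j by auto
  show ?case
  proof (cases "lt (var (p j) + var (q i)) (var (p i) + var (q j))")
    case True
    then show ?thesis using ij u by blast
  next
    case False
    define v'' where "v'' = var (p i) + var (q j) + v'"
    \<comment> \<open>The diagonals are different monomials, so the order compares them.\<close>
    have "Poly_Mapping.lookup (var (p i) + var (q j)) (p i) \<noteq>
        Poly_Mapping.lookup (var (p j) + var (q i)) (p i)"
      using ij \<open>i \<noteq> j\<close> by (simp add: lookup_add lookup_single when_def p_eq_iff p_neq_q[symmetric])
    with False have "lt (var (p i) + var (q j)) (var (p j) + var (q i))"
      using lt_total[OF lt] by metis
    then have "lt v'' v" unfolding v v''_def by (rule lt_add[OF lt])
    then have "lt v'' u" using less.prems(2) lt_trans[OF lt] by blast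
    moreover have "same_margins v v''"
      unfolding v v''_def using ij by (intro same_margins_add same_margins_swap)
    then have "same_margins u v''" using less.prems(1) same_margins_trans by blast
    moreover have "(\<Sum>k\<le>r. Poly_Mapping.lookup v'' (p k) - Poly_Mapping.lookup u (p k))
        < (\<Sum>k\<le>r. Poly_Mapping.lookup v (p k) - Poly_Mapping.lookup u (p k))"
    proof (rule sum_strict_mono_ex1)
      \<comment> \<open>The measure is the total excess of \<open>v\<close> over \<open>u\<close> in row \<open>p\<close>: the subtraction is
          truncated, so the increase at column \<open>i\<close>, where \<open>v\<close> falls short, does not count.\<close>
      have v''_at: "Poly_Mapping.lookup v'' (p k) =
          (if k = i then Poly_Mapping.lookup v (p k) + 1
           else if k = j then Poly_Mapping.lookup v (p k) - 1 else Poly_Mapping.lookup v (p k))"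
        if "k \<le> r" for k
        using ij that \<open>i \<noteq> j\<close>
        by (auto simp: v v''_def lookup_add lookup_single when_def p_eq_iff p_neq_q[symmetric])
      show "\<forall>k\<in>{..r}. Poly_Mapping.lookup v'' (p k) - Poly_Mapping.lookup u (p k)
          \<le> Poly_Mapping.lookup v (p k) - Poly_Mapping.lookup u (p k)"
        using less_i by (auto simp: v''_at)
      show "\<exists>k\<in>{..r}. Poly_Mapping.lookup v'' (p k) - Poly_Mapping.lookup u (p k)
          < Poly_Mapping.lookup v (p k) - Poly_Mapping.lookup u (p k)"
        using less_j ij \<open>i \<noteq> j\<close> by (intro bexI[of _ j]) (auto simp: v''_at)
    qed simp
    ultimately show ?thesis using less.hyps by blast
  qed
qed

text \<open>
  By saturation, \<open>f\<close> contains besides its initial monomial a smaller one with the same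
  margins, so the initial monomial of some minor divides that of \<open>f\<close>.
\<close>

lemma quadratic_groebner_basis_minors:
  assumes lt: "monomial_order lt" and r: "r \<ge> 1"
  shows "\<exists>G. quadratic_groebner_basis lt G (join_meet_ideal :: ('a, 'k::field) mpoly set)"
proof -
  let ?I = "join_meet_ideal :: ('a, 'k) mpoly set"
  define G where "G = {g. \<exists>a b. g = (basic_binomial a b :: ('a, 'k) mpoly)} - {0}"
  let ?in = "\<lambda>S :: ('a, 'k) mpoly set. {mono_poly (initial_monomial lt g) :: ('a, 'k) mpoly | g. g \<in> S}"
  have "G = (\<lambda>(a, b). basic_binomial a b) ` UNIV - {0}" unfolding G_def by auto
  then have finite: "finite G" by simp
  have subset: "G \<subseteq> ?I" unfolding G_def using basic_binomial_in_ideal by auto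
  have leading: "mono_poly (initial_monomial lt f) \<in> ideal_gen (?in G)" if f: "f \<in> ?I" "f \<noteq> 0" for f
  proof -
    let ?u = "initial_monomial lt f"
    have u: "?u \<in> Poly_Mapping.keys f" by (rule initial_monomial_in_keys[OF lt f(2)])
    obtain v where v: "same_margins ?u v" "v \<in> Poly_Mapping.keys f" "v \<noteq> ?u"
      using saturated_mem_not_alone[OF saturated_same_margins f(1) _ u, of ?u]
      by (auto simp: same_margins_def)
    have "lt v ?u" using lt_initial_monomial[OF lt f(2)] v by blast
    with v(1) obtain i j t where ij: "i \<le> r" "j \<le> r" and u_eq: "?u = var (p i) + var (q j) + t"
      and less: "lt (var (p j) + var (q i)) (var (p i) + var (q j))"
      using minor_divides_larger_monomial[OF lt] by blast
    let ?g = "mono_poly (var (p i) + var (q j)) - mono_poly (var (p j) + var (q i)) :: ('a, 'k) mpoly"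
    note init = initial_monomial_diff[OF lt less, where ?'k = 'k]
    have "?g \<in> G \<or> - ?g \<in> G"
      using swap_binomial_basic[OF ij, where ?'k = 'k] init(2) unfolding G_def
      by fastforce
    moreover have "initial_monomial lt (- ?g) = initial_monomial lt ?g"
      by (rule initial_monomial_uminus)
    ultimately have "mono_poly (var (p i) + var (q j)) \<in> ?in G"
      using init(1) by (auto intro: exI[of _ ?g] exI[of _ "- ?g"])
    then have "mono_poly (var (p i) + var (q j)) \<in> ideal_gen (?in G)"
      unfolding ideal_gen_def by (rule ring_module.span_base)
    then have "mono_poly t * mono_poly (var (p i) + var (q j)) \<in> ideal_gen (?in G)"
      unfolding ideal_gen_def by (rule ring_module.span_scale)
    then show ?thesis by (simp add: u_eq mono_poly_def mult_single add.commute)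
  qed
  have "?in {f. f \<in> ?I \<and> f \<noteq> 0} \<subseteq> ideal_gen (?in G)"
    using leading by blast
  then have "initial_ideal lt ?I \<subseteq> ideal_gen (?in G)"
    unfolding initial_ideal_def ideal_gen_def
    by (intro ring_module.span_minimal ring_module.subspace_span) simp
  moreover have "ideal_gen (?in G) \<subseteq> initial_ideal lt ?I"
    unfolding initial_ideal_def ideal_gen_def
    using subset by (intro ring_module.span_mono) (auto simp: G_def)
  moreover have "?I \<noteq> {0}"
  proof -
    have "var (p 0) + var (q 1) \<noteq> var (p 1) + var (q 0)"
    proof
      assume "var (p 0) + var (q 1) = var (p 1) + var (q 0)"
      from this[THEN arg_cong, of "\<lambda>m. Poly_Mapping.lookup m (p 0)"] r show False
        by (simp add: lookup_add lookup_single when_def p_eq_iff p_neq_q[symmetric])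
    qed
    then have "(basic_binomial (p 1) (q 0) :: ('a, 'k) mpoly) \<noteq> 0"
      using r by (auto simp: basic_binomial_eq inf_pq sup_pq dest: arg_cong[of _ _ Poly_Mapping.keys])
    then show ?thesis using basic_binomial_in_ideal by blast
  qed
  ultimately have "quadratic_groebner_basis lt G ?I"
    unfolding quadratic_groebner_basis_def groebner_basis_def
    using finite subset total_degree_basic_binomial by (auto simp: G_def)
  then show ?thesis by blast
qed

end

section \<open>A triple that every quadratic Groebner basis misses\<close>

text \<open>
  Congruence of monomials modulo the basic binomials, generated by single exchanges in both
  directions.
\<close>

inductive exchange :: "'a::lattice monomial \<Rightarrow> 'a monomial \<Rightarrow> bool" where
  exchange_refl: "exchange u u"
| exchange_step: "exchange u (var a + var b + t) \<Longrightarrow> exchange u (var (inf a b) + var (sup a b) + t)"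
| exchange_unstep: "exchange u (var (inf a b) + var (sup a b) + t) \<Longrightarrow> exchange u (var a + var b + t)"

lemma exchange_diff_in_ideal:
  fixes u v :: "'a::{finite,lattice} monomial"
  assumes "exchange u v"
  shows "(mono_poly u - mono_poly v :: ('a, 'k::field) mpoly) \<in> join_meet_ideal"
  using assms
proof induction
  case (exchange_refl u)
  show ?case by (simp add: join_meet_ideal_def ideal_gen_def ring_module.span_zero)
next
  have step: "(mono_poly (var a + var b + t) - mono_poly (var (inf a b) + var (sup a b) + t) :: ('a, 'k) mpoly)
      \<in> join_meet_ideal" for a b :: 'a and t
  proof -
    have "(mono_poly t * basic_binomial a b :: ('a, 'k) mpoly) \<in> join_meet_ideal"
      using basic_binomial_in_ideal unfolding join_meet_ideal_def ideal_gen_def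
      by (rule ring_module.span_scale)
    then show ?thesis
      by (simp add: basic_binomial_eq mono_poly_def algebra_simps mult_single)
  qed
  {
    case (exchange_step u a b t)
    from ring_module.span_add[OF exchange_step.IH[unfolded join_meet_ideal_def ideal_gen_def]
        step[of a b t, unfolded join_meet_ideal_def ideal_gen_def]]
    show ?case unfolding join_meet_ideal_def ideal_gen_def by simp
  next
    case (exchange_unstep u a b t)
    from ring_module.span_diff[OF exchange_unstep.IH[unfolded join_meet_ideal_def ideal_gen_def]
        step[of a b t, unfolded join_meet_ideal_def ideal_gen_def]]
    show ?case unfolding join_meet_ideal_def ideal_gen_def by (simp add: algebra_simps)
  }
qed

lemma deg_le_total_degree:
  fixes p :: "('a::finite, 'k::field) mpoly"
  assumes "m \<in> Poly_Mapping.keys p"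
  shows "deg m \<le> total_degree p"
proof -
  have "deg m = (\<Sum>a\<in>Poly_Mapping.keys m. Poly_Mapping.lookup m a)"
    unfolding weight_def by (rule sum.mono_neutral_cong_right) (auto simp: in_keys_iff)
  then show ?thesis unfolding total_degree_def using assms by simp
qed

lemma monomial_split:
  assumes "(m :: 'a monomial) \<noteq> 0"
  obtains a m' where "m = var a + m'"
proof -
  obtain a where "Poly_Mapping.lookup m a > 0"
    using assms by (auto simp: poly_mapping_eq_iff fun_eq_iff)
  then have "m = var a + (m - var a)"
    by (intro poly_mapping_eqI) (auto simp: lookup_add lookup_minus lookup_single when_def)
  then show thesis by (rule that)
qed

lemma deg_eq_0: "deg m = 0 \<Longrightarrow> m = 0"
  by (auto simp: weight_def intro: poly_mapping_eqI)

lemma deg_le_2_cases: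
  fixes m :: "'a::finite monomial"
  assumes "deg m \<le> 2"
  obtains (low) "deg m \<le> 1" | (pair) a b where "m = var a + var b"
proof (cases "deg m \<le> 1")
  case False
  then obtain a m' where m: "m = var a + m'" by (metis monomial_split weight_zero zero_le)
  with False have "m' \<noteq> 0" by (auto simp: weight_add)
  then obtain b m'' where m': "m' = var b + m''" by (rule monomial_split)
  have "m'' = 0" using assms by (intro deg_eq_0) (simp add: m m' weight_add)
  then show thesis using pair m m' by simp
qed (rule low)

lemma var_add_eq_iff:
  "var a + var b = var c + var d \<longleftrightarrow> a = c \<and> b = d \<or> a = d \<and> b = c"
proof
  assume eq: "var a + var b = var c + var d"
  have "Poly_Mapping.lookup (var a + var b) x = Poly_Mapping.lookup (var c + var d) x" for x
    by (simp only: eq)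
  from this[of a] this[of b] show "a = c \<and> b = d \<or> a = d \<and> b = c"
    by (auto simp: lookup_add lookup_single when_def split: if_splits)
qed (auto simp: add.commute)

text \<open>
  Exchanges involve two variables, so they do not apply to monomials of degree at most 1.
\<close>

lemma saturated_low:
  fixes C :: "'a::{finite,lattice} monomial set"
  assumes "\<And>m. m \<in> C \<Longrightarrow> deg m \<le> 1"
  shows "saturated C"
proof -
  have "var a + var b + t \<notin> C" for a b t
    using assms[of "var a + var b + t"] by (auto simp: weight_add)
  then show ?thesis unfolding saturated_def by blast
qed

text \<open>
  A monomial of degree 2 leaves no cofactor \<open>t\<close> in an exchange, and the comparable pair
  \<open>a \<sqinter> b, a \<squnion> b\<close> has the same meet and join as \<open>a, b\<close>.
\<close>

lemma saturated_pairs: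
  fixes x y :: "'a::{finite,lattice}"
  shows "saturated {var u + var v | u v. inf u v = x \<and> sup u v = y}" (is "saturated ?C")
  unfolding saturated_def
proof (intro allI)
  fix a b and t :: "'a monomial"
  have mem: "var c + var d + t \<in> ?C \<longleftrightarrow> t = 0 \<and> inf c d = x \<and> sup c d = y" for c d :: 'a
  proof
    assume "var c + var d + t \<in> ?C"
    then obtain u v where eq: "var c + var d + t = var u + var v" and uv: "inf u v = x" "sup u v = y"
      by blast
    from eq[THEN arg_cong, of deg] have t: "t = 0" by (intro deg_eq_0) (simp add: weight_add)
    with eq have "c = u \<and> d = v \<or> c = v \<and> d = u" using var_add_eq_iff[of c d u v] by simp
    with t uv show "t = 0 \<and> inf c d = x \<and> sup c d = y" by (auto simp: inf_commute sup_commute)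
  qed auto
  show "var a + var b + t \<in> ?C \<longleftrightarrow> var (inf a b) + var (sup a b) + t \<in> ?C"
    unfolding mem by (simp add: inf_absorb1 sup_absorb2 le_supI1)
qed

text \<open>
  The products \<open>u v\<close> considered here make up the class of \<open>s t\<close>.
\<close>

definition lightest_pair :: "('a::lattice \<Rightarrow> nat) \<Rightarrow> 'a \<Rightarrow> 'a \<Rightarrow> bool" where
  "lightest_pair w s t \<longleftrightarrow> (\<forall>u v. inf u v = inf s t \<longrightarrow> sup u v = sup s t \<longrightarrow>
     {u, v} = {s, t} \<or> w s + w t < w u + w v)"

lemma lightest_pair_commute: "lightest_pair w s t \<Longrightarrow> lightest_pair w t s"
  unfolding lightest_pair_def by (simp add: inf_commute sup_commute insert_commute add.commute)

definition quadratic_for_all_orders :: "'a::{finite,lattice} itself \<Rightarrow> 'k::field itself \<Rightarrow> bool" where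
  "quadratic_for_all_orders (L :: 'a itself) (K :: 'k itself) \<longleftrightarrow> (\<forall>lt. monomial_order lt \<longrightarrow>
     (\<exists>G. quadratic_groebner_basis lt G (join_meet_ideal :: ('a, 'k) mpoly set)))"

text \<open>
  Suppose that \<open>m\<close> is lighter. Then \<open>x y z\<close> is the initial monomial of \<open>x y z - m\<close> for an
  order refining the weight, so the initial monomial of some quadric \<open>g\<close> of the basis divides
  \<open>x y z\<close>. Its degree is 2, as monomials of lower degree are alone in their classes, and it
  is a product of two of \<open>x\<close>, \<open>y\<close>, \<open>z\<close>. Then \<open>g\<close> contains another monomial of the same
  class; that one is heavier by assumption, hence larger than the initial monomial of \<open>g\<close>.
\<close>

lemma light_triple_is_minimal:
  fixes w :: "'a::{finite,lattice} \<Rightarrow> nat" and L :: "'a itself" and K :: "'k::field itself"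
  assumes quadratic: "quadratic_for_all_orders L K"
    and distinct: "x \<noteq> y" "x \<noteq> z" "y \<noteq> z"
    and light: "lightest_pair w x y" "lightest_pair w x z" "lightest_pair w y z"
    and exchange: "exchange (var x + var y + var z) m"
  shows "w x + w y + w z \<le> weight w m"
proof (rule ccontr)
  assume heavier: "\<not> ?thesis"
  let ?I = "join_meet_ideal :: ('a, 'k) mpoly set"
  let ?u = "var x + var y + var z"
  obtain lt where lt: "monomial_order lt" and w_lt: "\<And>u v. weight w u < weight w v \<Longrightarrow> lt u v"
    by (rule weight_refining_order[of w]) blast
  obtain G where "quadratic_groebner_basis lt G ?I"
    using quadratic lt unfolding quadratic_for_all_orders_def by blast
  then have G: "G \<subseteq> ?I" "0 \<notin> G" "\<And>g. g \<in> G \<Longrightarrow> total_degree g = 2"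
    and initial: "initial_ideal lt ?I = ideal_gen {mono_poly (initial_monomial lt g) | g. g \<in> G}"
    unfolding quadratic_groebner_basis_def groebner_basis_def by auto
  have "lt m ?u" using heavier by (intro w_lt) (simp add: weight_add)
  note init = initial_monomial_diff[OF lt this, where ?'k = 'k]
  have "mono_poly ?u \<in> {mono_poly (initial_monomial lt f) :: ('a, 'k) mpoly | f. f \<in> ?I \<and> f \<noteq> 0}"
    using exchange_diff_in_ideal[OF exchange, where ?'k = 'k] init
    by (intro CollectI exI[of _ "mono_poly ?u - mono_poly m"]) simp
  then have "mono_poly ?u \<in> initial_ideal lt ?I"
    unfolding initial_ideal_def ideal_gen_def by (rule ring_module.span_base)
  then have "mono_poly ?u \<in> ideal_gen (mono_poly ` (initial_monomial lt ` G) :: ('a, 'k) mpoly set)"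
    unfolding initial by (simp add: image_image Setcompr_eq_image)
  then obtain g t where g: "g \<in> G" and u_eq: "?u = initial_monomial lt g + t"
    using mono_poly_in_monomial_ideal by blast
  let ?n = "initial_monomial lt g"
  have g_props: "g \<in> ?I" "g \<noteq> 0" using g G by auto
  have n: "?n \<in> Poly_Mapping.keys g" by (rule initial_monomial_in_keys[OF lt g_props(2)])
  have "deg ?n \<le> 2" using deg_le_total_degree[OF n] G(3)[OF g] by simp
  then show False
  proof (cases rule: deg_le_2_cases)
    case low
    then have "saturated {?n}" by (intro saturated_low) simp
    then show False using saturated_mem_not_alone[OF _ g_props(1) _ n, of "{?n}"] by blast
  next
    case (pair a b)
    have at: "Poly_Mapping.lookup ?u e = Poly_Mapping.lookup (var a + var b + t) e" for e
      using u_eq pair by simp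
    \<comment> \<open>The monomial \<open>x y z\<close> is squarefree.\<close>
    have "a \<noteq> b" "a \<in> {x, y, z}" "b \<in> {x, y, z}"
      using at[of a] at[of b] distinct
      by (auto simp: lookup_add lookup_single when_def split: if_splits)
    then have light_ab: "lightest_pair w a b" using light lightest_pair_commute by auto
    let ?C = "{var u + var v | u v. inf u v = inf a b \<and> sup u v = sup a b}"
    have "?n \<in> ?C" unfolding pair by blast
    then obtain n' where n': "n' \<in> ?C" "n' \<in> Poly_Mapping.keys g" "n' \<noteq> ?n"
      using saturated_mem_not_alone[OF saturated_pairs g_props(1) _ n] by blast
    from n'(1) obtain u v where uv: "n' = var u + var v" "inf u v = inf a b" "sup u v = sup a b" by blast
    then have "{u, v} \<noteq> {a, b}" using n'(3) pair by (auto simp: doubleton_eq_iff add.commute)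
    then have "w a + w b < w u + w v" using light_ab uv unfolding lightest_pair_def by blast
    then have "lt ?n n'" by (intro w_lt) (simp add: pair uv weight_add)
    moreover have "lt n' ?n" by (rule lt_initial_monomial[OF lt g_props(2) n'(2,3)])
    ultimately show False using lt_trans[OF lt] lt_irrefl[OF lt] by blast
  qed
qed

text \<open>
  An element of weight at least 3 cannot take part in a pair of total weight at most 2, which leaves
  the competitors inside \<open>S\<close>.
\<close>

lemma lightest_pair_within:
  assumes "\<And>u. u \<notin> S \<Longrightarrow> w u \<ge> 3" "w s + w t \<le> 2"
    and "\<And>u v. u \<in> S \<Longrightarrow> v \<in> S \<Longrightarrow> inf u v = inf s t \<Longrightarrow> sup u v = sup s t \<Longrightarrow>
      {u, v} = {s, t} \<or> w s + w t < w u + w v"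
  shows "lightest_pair w s t"
  unfolding lightest_pair_def
proof (intro allI impI)
  fix u v assume uv: "inf u v = inf s t" "sup u v = sup s t"
  show "{u, v} = {s, t} \<or> w s + w t < w u + w v"
  proof (cases "u \<in> S \<and> v \<in> S")
    case False
    then have "3 \<le> w u + w v" using assms(1)[of u] assms(1)[of v] by auto
    with assms(2) show ?thesis by simp
  qed (use assms(3) uv in blast)
qed

lemma exchange_to_meet_join:
  "exchange u (var a + var b + t) \<Longrightarrow> inf a b = c \<Longrightarrow> sup a b = d \<Longrightarrow> exchange u (var c + var d + t)"
  using exchange_step by blast

lemma exchange_from_meet_join:
  "exchange u (var c + var d + t) \<Longrightarrow> inf a b = c \<Longrightarrow> sup a b = d \<Longrightarrow> exchange u (var a + var b + t)"
  using exchange_unstep by blast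

section \<open>Configurations excluded by quadratic Groebner bases\<close>

locale always_quadratic =
  fixes L :: "'a::{finite,lattice} itself" and K :: "'k::field itself"
  assumes quadratic: "quadratic_for_all_orders L K"
begin

text \<open>
  Let \<open>a\<close> and \<open>b\<close> be complements of \<open>c\<close> in the interval from \<open>lo\<close> to \<open>hi\<close>. Then
  \<open>a lo hi\<close>, \<open>a b c\<close> and \<open>b lo hi\<close> are congruent. If \<open>a\<close> has weight 1 while \<open>b\<close>, \<open>lo\<close> and
  \<open>hi\<close> have weight 0, then \<open>a lo hi\<close> is heavier than \<open>b lo hi\<close>. Yet each of its pairs is the
  lightest one of its class: the only incomparable pair in question, \<open>a, b\<close>, could compete just
  with \<open>lo, hi\<close>, and is heavier.
\<close>

lemma cancel:
  fixes a b c :: 'a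
  assumes inf: "inf a c = inf b c" and sup: "sup a c = sup b c"
  shows "a = b"
proof (rule ccontr)
  assume "a \<noteq> b"
  define lo where "lo = inf a c"
  define hi where "hi = sup a c"
  have b_eq: "lo = inf b c" "hi = sup b c" using inf sup by (simp_all add: lo_def hi_def)
  have le: "lo \<le> a" "a \<le> hi" "lo \<le> c" "c \<le> hi" by (simp_all add: lo_def hi_def)
  have le': "lo \<le> b" "b \<le> hi" by (simp_all add: b_eq)
  have ne: "a \<noteq> lo" "a \<noteq> hi"
  proof -
    show "a \<noteq> lo"
    proof
      assume "a = lo"
      then have "hi = c" unfolding hi_def using le by (intro sup_absorb2) simp
      then have "lo = b" unfolding b_eq(1) using le' by (intro inf_absorb1) simp
      with \<open>a = lo\<close> \<open>a \<noteq> b\<close> show False by simp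
    qed
    show "a \<noteq> hi"
    proof
      assume "a = hi"
      then have "lo = c" unfolding lo_def using le by (intro inf_absorb2) simp
      then have "hi = b" unfolding b_eq(2) using le' by (intro sup_absorb1) simp
      with \<open>a = hi\<close> \<open>a \<noteq> b\<close> show False by simp
    qed
  qed
  have "lo \<noteq> hi" using ne le by order
  let ?S = "{a, b, lo, hi}"
  define w :: "'a \<Rightarrow> nat" where "w e = (if e = a then 1 else if e \<in> ?S then 0 else 3)" for e
  note within = lightest_pair_within[of ?S w]
  have exchange: "exchange (var a + var lo + var hi) (var b + var lo + var hi)"
  proof -
    have "exchange (var a + var lo + var hi) (var lo + var hi + var a)"
      using exchange_refl by (simp add: ac_simps)
    then have "exchange (var a + var lo + var hi) (var b + var c + var a)"
      by (rule exchange_from_meet_join) (simp_all add: b_eq)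
    then have "exchange (var a + var lo + var hi) (var a + var c + var b)" by (simp add: ac_simps)
    then have "exchange (var a + var lo + var hi) (var lo + var hi + var b)"
      by (rule exchange_to_meet_join) (simp_all add: lo_def hi_def)
    then show ?thesis by (simp add: ac_simps)
  qed
  have light: "lightest_pair w s t" if st: "s \<in> ?S" "t \<in> ?S" "s \<le> t" "s \<noteq> t" for s t
  proof (rule within)
    have "w e \<le> 1" if "e \<in> ?S" for e using that by (auto simp: w_def)
    from this[OF st(1)] this[OF st(2)] show "w s + w t \<le> 2" by simp
    fix u v assume uv: "u \<in> ?S" "v \<in> ?S" "inf u v = inf s t" "sup u v = sup s t"
    then have eqs: "inf u v = s" "sup u v = t" using st by (simp_all add: inf_absorb1 sup_absorb2)
    show "{u, v} = {s, t} \<or> w s + w t < w u + w v"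
    proof (cases "u \<le> v \<or> v \<le> u")
      case True
      then have "{u, v} = {inf u v, sup u v}"
        by (auto simp: inf_absorb1 inf_absorb2 sup_absorb1 sup_absorb2)
      then show ?thesis unfolding eqs ..
    next
      case False
      have "lo \<le> e" "e \<le> hi" if "e \<in> ?S" for e using that le le' by auto
      with False uv(1,2) have "u \<noteq> lo" "u \<noteq> hi" "v \<noteq> lo" "v \<noteq> hi" by blast+
      with False uv(1,2) have ab: "u = a \<and> v = b \<or> u = b \<and> v = a" by auto
      have "s \<le> u" "s \<le> v" "u \<le> t" "v \<le> t" by (simp_all flip: eqs)
      with ab False have "s \<noteq> a" "t \<noteq> a" by auto
      then have "w s = 0" "w t = 0" using st by (auto simp: w_def)
      moreover have "w u + w v = 1" using ab \<open>a \<noteq> b\<close> by (auto simp: w_def)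
      ultimately show ?thesis by simp
    qed
  qed (auto simp: w_def)
  have "lightest_pair w lo a" "lightest_pair w a hi" "lightest_pair w lo hi"
    using le ne \<open>lo \<noteq> hi\<close> by (auto intro!: light)
  then have "w a + w lo + w hi \<le> weight w (var b + var lo + var hi)"
    using ne \<open>lo \<noteq> hi\<close> lightest_pair_commute[of w lo a] exchange
    by (intro light_triple_is_minimal[OF quadratic]) auto
  then show False using \<open>a \<noteq> b\<close> ne by (simp add: weight_add w_def)
qed

text \<open>
  With \<open>m\<close> the common vertex, \<open>lo\<close> the bottom and \<open>hi\<close> the top, \<open>a b hi\<close> is congruent to
  \<open>lo m hi\<close> and to \<open>lo c d\<close>. The weights make \<open>lo c d\<close> light and \<open>m\<close> heavy, so that the pair
  \<open>lo, m\<close>, which would replace \<open>a, b\<close>, is not lighter.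
\<close>

lemma no_stacked_squares:
  fixes a b c d :: 'a
  assumes ab: "\<not> a \<le> b" "\<not> b \<le> a" and cd: "\<not> c \<le> d" "\<not> d \<le> c" and m: "sup a b = inf c d"
  shows False
proof -
  define lo where "lo = inf a b"
  define hi where "hi = sup c d"
  define m where "m = inf c d"
  have m_eq: "m = sup a b" by (simp add: m_def m)
  have below: "a \<le> m" "b \<le> m" "lo \<le> a" "lo \<le> b" by (simp_all add: m_eq lo_def)
  have above: "m \<le> c" "m \<le> d" "c \<le> hi" "d \<le> hi" by (simp_all add: m_def hi_def)
  let ?X = "{a, b, hi}" and ?Z = "{lo, c, d}"
  define w :: "'a \<Rightarrow> nat" where "w e = (if e \<in> ?X then 1 else if e \<in> ?Z then 0 else 3)" for e
  note within = lightest_pair_within[of "?X \<union> ?Z" w]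
  have X: "w a = 1" "w b = 1" "w hi = 1" by (simp_all add: w_def)
  have not_le: "\<not> c \<le> m" "\<not> d \<le> m" "\<not> hi \<le> m" "\<not> m \<le> a" "\<not> m \<le> b"
    using ab cd below above by (meson order.trans)+
  have "exchange (var a + var b + var hi) (var lo + var c + var d)"
  proof -
    have "exchange (var a + var b + var hi) (var lo + var m + var hi)"
      using exchange_refl by (rule exchange_to_meet_join) (simp_all add: lo_def m_def m)
    then have "exchange (var a + var b + var hi) (var m + var hi + var lo)" by (simp add: ac_simps)
    then have "exchange (var a + var b + var hi) (var c + var d + var lo)"
      by (rule exchange_from_meet_join) (simp_all add: hi_def m_def)
    then show ?thesis by (simp add: ac_simps)
  qed
  moreover have "lightest_pair w a b"
  proof (rule within)
    fix u v assume uv: "u \<in> ?X \<union> ?Z" "v \<in> ?X \<union> ?Z" "inf u v = inf a b" "sup u v = sup a b"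
    then have "u \<le> m" "v \<le> m" using m by (metis m_def sup.cobounded1 sup.cobounded2)+
    then have "u \<in> {a, b, lo}" "v \<in> {a, b, lo}" using uv not_le by blast+
    then show "{u, v} = {a, b} \<or> w a + w b < w u + w v"
      using uv(3,4) ab below not_le m unfolding m_def
      by (auto simp: inf_absorb1 inf_absorb2 sup_absorb1 sup_absorb2)
  qed (auto simp: w_def)
  moreover have with_top: "lightest_pair w e hi" if e: "e \<in> {a, b}" for e
  proof (rule within)
    have "e \<le> m" "\<not> m \<le> e" using e below not_le by auto
    fix u v assume uv: "u \<in> ?X \<union> ?Z" "v \<in> ?X \<union> ?Z" "inf u v = inf e hi" "sup u v = sup e hi"
    have "e \<le> hi" using \<open>e \<le> m\<close> above by order
    then have "e \<le> u" "e \<le> v" "inf u v = e" "sup u v = hi"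
      using uv by (metis inf.absorb1 inf.cobounded1 inf.cobounded2 sup.absorb2)+
    then have "u \<in> {e, hi, c, d}" "v \<in> {e, hi, c, d}" using uv e ab below by (auto intro: order.antisym)
    moreover have "\<not> (m \<le> u \<and> m \<le> v)"
      using \<open>inf u v = e\<close> \<open>\<not> m \<le> e\<close> by (metis le_inf_iff)
    ultimately have "u = e \<or> v = e" using above by auto
    then have "{u, v} = {e, hi}"
      using \<open>e \<le> u\<close> \<open>e \<le> v\<close> \<open>sup u v = hi\<close> by (auto simp: sup_absorb1 sup_absorb2)
    then show "{u, v} = {e, hi} \<or> w e + w hi < w u + w v" ..
  qed (use e in \<open>auto simp: w_def\<close>)
  moreover have "a \<noteq> b" "a \<noteq> hi" "b \<noteq> hi" using ab below above not_le by auto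
  ultimately have "w a + w b + w hi \<le> weight w (var lo + var c + var d)"
    by (intro light_triple_is_minimal[OF quadratic]) auto
  moreover have "w lo = 0" "w c = 0" "w d = 0"
    using ab cd below above not_le by (auto simp: w_def)
  ultimately show False by (simp add: weight_add X)
qed

text \<open>
  With \<open>t\<close> the top of the cube, \<open>x1 x2 x3\<close> is congruent to \<open>y (x1 \<squnion> x2) x3\<close> and to
  \<open>y y t\<close>. The weights make \<open>y\<close> and \<open>t\<close> light and the joins of two of the \<open>x\<close> heavy, which bars
  the only way of lowering a pair.
\<close>

lemma no_cube:
  fixes x1 x2 x3 y :: 'a
  assumes y: "inf x1 x2 = y" "inf x1 x3 = y" "inf x2 x3 = y"
    and not_below: "\<not> x3 \<le> sup x1 x2" "\<not> x2 \<le> sup x1 x3" "\<not> x1 \<le> sup x2 x3"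
    and indep: "inf (sup x1 x2) x3 = y"
  shows False
proof -
  define t where "t = sup (sup x1 x2) x3"
  have le: "x1 \<le> t" "x2 \<le> t" "x3 \<le> t" unfolding t_def by (simp_all add: le_supI1)
  have antichain: "\<not> x1 \<le> x2" "\<not> x2 \<le> x1" "\<not> x1 \<le> x3" "\<not> x3 \<le> x1" "\<not> x2 \<le> x3" "\<not> x3 \<le> x2"
    using not_below by (auto simp: le_supI1 le_supI2)
  let ?X = "{x1, x2, x3}" and ?Z = "{y, t}"
  define w :: "'a \<Rightarrow> nat" where "w e = (if e \<in> ?X then 1 else if e \<in> ?Z then 0 else 3)" for e
  have light: "lightest_pair w s s'"
    if S: "{s, s', s''} = ?X" and s: "inf s s' = y" "\<not> s'' \<le> sup s s'" "\<not> s \<le> s'" "\<not> s' \<le> s" for s s' s''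
  proof (rule lightest_pair_within[of "?X \<union> ?Z" w])
    fix u v assume uv: "u \<in> ?X \<union> ?Z" "v \<in> ?X \<union> ?Z" "inf u v = inf s s'" "sup u v = sup s s'"
    have "s'' \<le> t" using S le by auto
    then have "\<not> t \<le> sup s s'" using s(2) by order
    moreover have "u \<le> sup s s'" "v \<le> sup s s'" unfolding uv(4)[symmetric] by simp_all
    ultimately have mem: "u \<in> {s, s', y}" "v \<in> {s, s', y}"
      using uv(1,2) s(2) unfolding S[symmetric] by auto
    have "y \<le> s" "y \<le> s'" unfolding s(1)[symmetric] by simp_all
    moreover have "sup s s' \<noteq> s" "sup s s' \<noteq> s'" "sup s s' \<noteq> y" "s \<noteq> y" "s' \<noteq> y"
      using s(3,4) \<open>y \<le> s\<close> \<open>y \<le> s'\<close> by (metis sup.cobounded1 sup.cobounded2 order.trans)+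
    ultimately have "{u, v} = {s, s'}"
      using mem uv(3,4) s(1) by (auto simp: sup_absorb1 sup_absorb2)
    then show "{u, v} = {s, s'} \<or> w s + w s' < w u + w v" ..
  next
    have "w s = 1" "w s' = 1" using S by (auto simp: w_def)
    then show "w s + w s' \<le> 2" by simp
  qed (auto simp: w_def)
  have "exchange (var x1 + var x2 + var x3) (var y + var (sup x1 x2) + var x3)"
    using exchange_refl by (rule exchange_to_meet_join) (simp_all add: y)
  then have "exchange (var x1 + var x2 + var x3) (var (sup x1 x2) + var x3 + var y)"
    by (simp add: ac_simps)
  then have "exchange (var x1 + var x2 + var x3) (var y + var t + var y)"
    by (rule exchange_to_meet_join) (simp_all add: indep t_def)
  moreover have "lightest_pair w x1 x2" "lightest_pair w x1 x3" "lightest_pair w x2 x3"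
    using y not_below antichain by (intro light[of _ _ x3] light[of _ _ x2] light[of _ _ x1]; auto)+
  ultimately have "w x1 + w x2 + w x3 \<le> weight w (var y + var t + var y)"
    using antichain by (intro light_triple_is_minimal[OF quadratic]) auto
  moreover have "w y = 0" "w t = 0"
    using antichain le y by (auto simp: w_def)
  ultimately show False by (simp add: weight_add w_def)
qed

text \<open>
  In a grid of three by three elements let \<open>x1\<close>, \<open>x2\<close>, \<open>x3\<close> be the antidiagonal, with
  \<open>lo\<close> at the bottom corner and \<open>u1\<close>, \<open>u3\<close> the elements below the top corner. Then \<open>x1 x2 x3\<close>
  and \<open>lo u1 u3\<close> are two terms of the determinant of the grid that share no entry.
  They are congruent, but each pair of the \<open>x\<close> can only be exchanged for a pair that contains
  one of the remaining, heavy elements.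
\<close>

lemma no_grid:
  fixes x1 x2 x3 :: 'a
  defines "u1 \<equiv> sup x1 x2" and "u3 \<equiv> sup x3 x2"
  assumes middle: "inf u1 u3 = x2" "x2 \<le> sup x1 x3"
    and below: "\<not> inf x1 x2 \<le> x3" "\<not> inf x3 x2 \<le> x1"
    and above: "\<not> u1 \<le> u3" "\<not> u3 \<le> u1"
  shows False
proof -
  define lo where "lo = inf x1 x3"
  have le: "lo \<le> x1" "lo \<le> x3" "x1 \<le> u1" "x2 \<le> u1" "x2 \<le> u3" "x3 \<le> u3"
    by (simp_all add: lo_def u1_def u3_def)
  have antichain: "\<not> x1 \<le> x2" "\<not> x2 \<le> x1" "\<not> x1 \<le> x3" "\<not> x3 \<le> x1" "\<not> x2 \<le> x3" "\<not> x3 \<le> x2"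
  proof -
    have "\<not> x1 \<le> u3" "\<not> x3 \<le> u1" using above le by (auto simp: u1_def u3_def)
    then show "\<not> x1 \<le> x2" "\<not> x3 \<le> x2" "\<not> x1 \<le> x3" "\<not> x3 \<le> x1" using le by order+
    show "\<not> x2 \<le> x1" "\<not> x2 \<le> x3" using below by (auto simp: le_infI2)
  qed
  let ?X = "{x1, x2, x3}" and ?Z = "{lo, u1, u3}"
  define w :: "'a \<Rightarrow> nat" where "w e = (if e \<in> ?X then 1 else if e \<in> ?Z then 0 else 3)" for e
  have X: "w x1 = 1" "w x2 = 1" "w x3 = 1" by (simp_all add: w_def)
  \<comment> \<open>The pairs \<open>x1, x2\<close> and \<open>x3, x2\<close> are interchanged by the reflection of the grid.\<close>
  have side: "lightest_pair w p x2"
    if p: "(p, p', u, u') = (x1, x3, u1, u3) \<or> (p, p', u, u') = (x3, x1, u3, u1)" for p p' u u'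
  proof (rule lightest_pair_within[of "?X \<union> ?Z" w])
    fix e f assume ef: "e \<in> ?X \<union> ?Z" "f \<in> ?X \<union> ?Z" "inf e f = inf p x2" "sup e f = sup p x2"
    have u: "sup p x2 = u" "\<not> u' \<le> u" "\<not> inf p x2 \<le> p'" "lo \<le> p'" "p \<le> u" "x2 \<le> u"
      "inf p x2 \<noteq> p" "inf p x2 \<noteq> x2" "\<not> p \<le> x2" "\<not> x2 \<le> p"
      using p above below le antichain by (auto simp: u1_def u3_def) (metis inf.cobounded1 inf.cobounded2)+
    have S: "?X \<union> ?Z = {p, x2, p', lo, u, u'}" using p by auto
    have "inf p x2 \<le> e" "inf p x2 \<le> f" unfolding ef(3)[symmetric] by simp_all
    moreover have "e \<le> u" "f \<le> u" unfolding u(1)[symmetric] ef(4)[symmetric] by simp_all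
    ultimately have "e \<in> {p, x2, u}" "f \<in> {p, x2, u}"
      using ef(1,2) u(2,3,4) unfolding S by (auto dest: order.trans)
    then have "{e, f} = {p, x2}"
      using ef(3) u by (auto simp: inf_absorb1 inf_absorb2 inf_commute)
    then show "{e, f} = {p, x2} \<or> w p + w x2 < w e + w f" ..
  next
    show "w p + w x2 \<le> 2" using p X by auto
  qed (auto simp: w_def)
  have outer: "lightest_pair w x1 x3"
  proof (rule lightest_pair_within[of "?X \<union> ?Z" w])
    fix e f assume ef: "e \<in> ?X \<union> ?Z" "f \<in> ?X \<union> ?Z" "inf e f = inf x1 x3" "sup e f = sup x1 x3"
    \<comment> \<open>A competitor lies neither above \<open>x1 \<sqinter> x2\<close> or \<open>x3 \<sqinter> x2\<close> nor below \<open>u1\<close> or \<open>u3\<close>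
        with both of its elements; among the six elements this leaves \<open>x1, x3\<close>.\<close>
    have ne: "\<not> inf x1 x2 \<le> inf e f" "\<not> inf x3 x2 \<le> inf e f" "\<not> sup x1 x3 \<le> u1" "\<not> sup x1 x3 \<le> u3"
      using below above le middle unfolding ef(3) u1_def u3_def by auto
    have "\<not> (e \<le> u1 \<and> f \<le> u1)" "\<not> (e \<le> u3 \<and> f \<le> u3)"
      using ne(3,4) unfolding ef(4)[symmetric] by auto
    moreover have "\<not> (inf x1 x2 \<le> e \<and> inf x1 x2 \<le> f)" "\<not> (inf x3 x2 \<le> e \<and> inf x3 x2 \<le> f)"
      using ne(1,2) by auto
    moreover have "inf x1 x2 \<le> u1" "inf x1 x2 \<le> u3" "inf x3 x2 \<le> u1" "inf x3 x2 \<le> u3" "lo \<le> u1" "lo \<le> u3"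
      using le by (auto intro: le_infI1 le_infI2 order.trans)
    ultimately have "{e, f} = {x1, x3}"
      using ef(1,2) le by auto
    then show "{e, f} = {x1, x3} \<or> w x1 + w x3 < w e + w f" ..
  qed (simp_all add: X, simp add: w_def)
  have "exchange (var x1 + var x2 + var x3) (var x1 + var x3 + var x2)"
    using exchange_refl by (simp add: ac_simps)
  then have "exchange (var x1 + var x2 + var x3) (var lo + var (sup x1 x3) + var x2)"
    by (rule exchange_to_meet_join) (simp_all add: lo_def)
  then have "exchange (var x1 + var x2 + var x3) (var x2 + var (sup x1 x3) + var lo)"
    by (simp add: ac_simps)
  then have "exchange (var x1 + var x2 + var x3) (var u1 + var u3 + var lo)"
  proof (rule exchange_from_meet_join)
    show "sup u1 u3 = sup x1 x3"
      using middle(2) unfolding u1_def u3_def by (intro order.antisym) (auto simp: le_supI1 le_supI2)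
  qed (rule middle(1))
  then have "w x1 + w x2 + w x3 \<le> weight w (var u1 + var u3 + var lo)"
    using antichain side[of x1 x3 u1 u3] side[of x3 x1 u3 u1] lightest_pair_commute outer
    by (intro light_triple_is_minimal[OF quadratic]) auto
  moreover have "w lo = 0" "w u1 = 0" "w u3 = 0"
    using antichain le by (auto simp: w_def)
  ultimately show False by (simp add: weight_add X)
qed

end

section \<open>Rank and covering\<close>

text \<open>
  The chains whose lengths \<open>rank\<close> maximizes.
\<close>

definition chain_to :: "nat \<Rightarrow> 'a::{finite,lattice} \<Rightarrow> bool" where
  "chain_to r a \<longleftrightarrow> (\<exists>s :: nat \<Rightarrow> 'a. s 0 = Inf_fin UNIV \<and> s r = a \<and> (\<forall>i<r. s i < s (Suc i)))"

lemma least_le: "Inf_fin UNIV \<le> (x :: 'a::{finite,lattice})"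
  by (intro Inf_fin.coboundedI) auto

lemma rank_eq_Max: "rank a = Max {r. chain_to r a}"
  by (simp add: rank_def chain_to_def)

lemma finite_chain_lengths: "finite {r. chain_to r (a :: 'a::{finite,lattice})}"
proof -
  have "r < card (UNIV :: 'a set)" if chain: "chain_to r a" for r
  proof -
    obtain s :: "nat \<Rightarrow> 'a" where s: "\<forall>i<r. s i < s (Suc i)"
      using chain unfolding chain_to_def by blast
    have mono: "s i < s j" if "i < j" "j \<le> r" for i j
      using that
    proof (induction j)
      case (Suc j)
      then have "s j < s (Suc j)" using s by simp
      with Suc show ?case by (cases "i = j") auto
    qed simp
    have "inj_on s {..r}"
    proof (rule inj_onI)
      fix i j assume "i \<in> {..r}" "j \<in> {..r}" "s i = s j"
      then show "i = j" using mono[of i j] mono[of j i] by (cases i j rule: linorder_cases) auto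
    qed
    then have "card {..r} \<le> card (UNIV :: 'a set)" by (rule card_inj_on_le) auto
    then show ?thesis by simp
  qed
  then show ?thesis by (metis (mono_tags) finite_nat_set_iff_bounded mem_Collect_eq)
qed

lemma chain_to_extend:
  assumes "chain_to r a" "a < b"
  shows "chain_to (Suc r) b"
proof -
  obtain s where "s 0 = Inf_fin UNIV" "s r = a" "\<forall>i<r. s i < s (Suc i)"
    using assms(1) unfolding chain_to_def by blast
  then show ?thesis unfolding chain_to_def using assms(2)
    by (intro exI[of _ "s(Suc r := b)"]) (auto simp: less_Suc_eq)
qed

lemma chain_to_rank: "chain_to (rank a) a"
proof -
  have "chain_to 0 (Inf_fin UNIV :: 'a)" unfolding chain_to_def by auto
  then have "\<exists>r. chain_to r a"
    using chain_to_extend[of 0 "Inf_fin UNIV" a] least_le[of a] by (cases "a = Inf_fin UNIV") (auto simp: le_less)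
  then show ?thesis
    using Max_in[OF finite_chain_lengths, of a] by (auto simp: rank_eq_Max)
qed

lemma chain_to_le_rank: "chain_to r a \<Longrightarrow> r \<le> rank a"
  unfolding rank_eq_Max by (rule Max_ge) (simp_all add: finite_chain_lengths)

lemma rank_less: "a < b \<Longrightarrow> rank a < rank b"
  using chain_to_le_rank[OF chain_to_extend[OF chain_to_rank]] by (simp add: Suc_le_eq)

lemma eq_if_le_rank_eq: "a \<le> b \<Longrightarrow> rank a = rank b \<Longrightarrow> a = b"
  using rank_less[of a b] by (auto simp: le_less)

lemma rank_Suc_below:
  assumes "rank b = Suc n"
  obtains c where "c < b" "rank c = n"
proof -
  obtain s where s: "s 0 = Inf_fin UNIV" "s (Suc n) = b" "\<forall>i<Suc n. s i < s (Suc i)"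
    using chain_to_rank[of b] assms unfolding chain_to_def by auto
  then have "chain_to n (s n)" unfolding chain_to_def by (intro exI[of _ s]) auto
  then have "n \<le> rank (s n)" by (rule chain_to_le_rank)
  moreover have "s n < b" using s by auto
  then have "rank (s n) < Suc n" using rank_less assms by metis
  ultimately show thesis using that[of "s n"] \<open>s n < b\<close> by simp
qed

lemma rank_eq_0_iff: "rank a = 0 \<longleftrightarrow> a = Inf_fin UNIV"
proof
  assume "rank a = 0"
  then show "a = Inf_fin UNIV" using rank_less[of "Inf_fin UNIV" a] least_le[of a] by (auto simp: le_less)
next
  have "rank (Inf_fin UNIV :: 'a) = 0"
  proof (cases "rank (Inf_fin UNIV :: 'a)")
    case (Suc n)
    then obtain c :: 'a where "c < Inf_fin UNIV" by (rule rank_Suc_below)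
    then show ?thesis using least_le[of c] by simp
  qed
  then show "a = Inf_fin UNIV \<Longrightarrow> rank a = 0" by simp
qed

definition covers :: "'a::order \<Rightarrow> 'a \<Rightarrow> bool" where
  "covers a b \<longleftrightarrow> a < b \<and> (\<forall>z. a \<le> z \<longrightarrow> z \<le> b \<longrightarrow> z = a \<or> z = b)"

lemma covers_less: "covers a b \<Longrightarrow> a < b"
  and covers_between: "covers a b \<Longrightarrow> a \<le> z \<Longrightarrow> z \<le> b \<Longrightarrow> z = a \<or> z = b"
  by (simp_all add: covers_def)

lemma covers_if_rank: "a < b \<Longrightarrow> rank b = Suc (rank a) \<Longrightarrow> covers a b"
  unfolding covers_def using rank_less by (metis leD le_less less_Suc_eq_le not_less_eq)

lemma exists_cover:
  fixes a b :: "'a::{finite,lattice}"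
  assumes "a < b"
  obtains c where "covers a c"
proof -
  obtain c where c: "a < c" "\<And>z. a < z \<Longrightarrow> rank c \<le> rank z"
    using assms ex_has_least_nat[of "\<lambda>z. a < z" b rank] by blast
  have "covers a c" unfolding covers_def
    using c rank_less by (metis leD le_less)
  then show thesis by (rule that)
qed

lemma inf_of_covers:
  fixes y :: "'a::lattice"
  assumes "covers y a" "covers y b" "a \<noteq> b"
  shows "inf a b = y"
proof -
  have le: "y \<le> a" "y \<le> b" using assms(1,2)[THEN covers_less] by (auto simp: less_imp_le)
  then have "inf a b = y \<or> inf a b = a" "inf a b = y \<or> inf a b = b"
    using covers_between[OF assms(1), of "inf a b"] covers_between[OF assms(2), of "inf a b"] by auto
  then show ?thesis using assms(3) by auto
qed

lemma covers_not_le: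
  "covers y a \<Longrightarrow> covers y b \<Longrightarrow> a \<noteq> b \<Longrightarrow> \<not> a \<le> b"
  using covers_between[of y b a] covers_less[of y a] by (auto simp: less_imp_le)

section \<open>Modularity and covers\<close>

context always_quadratic
begin

text \<open>
  Both sides have the same meet and the same join with \<open>y\<close>.
\<close>

lemma modular:
  fixes x y z :: 'a
  assumes "x \<le> z"
  shows "sup x (inf y z) = inf (sup x y) z"
proof (rule cancel)
  let ?a = "sup x (inf y z)" and ?b = "inf (sup x y) z"
  have le: "?a \<le> ?b" using assms by (simp add: le_infI1 le_infI2 le_supI2)
  show "inf ?a y = inf ?b y"
  proof (rule order.antisym)
    show "inf ?a y \<le> inf ?b y" using le by (rule inf_mono) simp
    have "inf ?b y \<le> ?a" by (simp add: le_infI1 le_infI2 le_supI2)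
    then show "inf ?b y \<le> inf ?a y" by simp
  qed
  show "sup ?a y = sup ?b y"
  proof (rule order.antisym)
    show "sup ?a y \<le> sup ?b y" using le by (rule sup_mono) simp
    have "?b \<le> sup ?a y" by (simp add: le_infI1 le_supI1)
    then show "sup ?b y \<le> sup ?a y" by simp
  qed
qed

text \<open>
  The opposite sides of a quadrilateral \<open>p \<sqinter> q, p, q, p \<squnion> q\<close> in a modular lattice are isomorphic
  intervals; this and the next lemma are the case of two-element intervals.
\<close>

lemma covers_sup:
  fixes p q :: 'a
  assumes "covers (inf p q) p"
  shows "covers q (sup p q)"
  unfolding covers_def
proof (intro conjI allI impI)
  have "\<not> p \<le> q" using assms covers_less by (metis inf.absorb1 less_irrefl)
  then show "q < sup p q" by (metis less_le sup.cobounded1 sup.cobounded2)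
  fix z assume z: "q \<le> z" "z \<le> sup p q"
  have z_eq: "z = sup q (inf p z)"
    using modular[OF z(1), of p] z(2) by (simp add: inf_absorb2 sup_commute)
  have "inf p z = inf p q \<or> inf p z = p"
    using z(1) by (intro covers_between[OF assms]) (auto intro: le_infI2)
  then show "z = q \<or> z = sup p q"
    using z_eq by (metis inf_commute sup_commute sup_inf_absorb)
qed

lemma covers_inf:
  fixes p q :: 'a
  assumes "covers q (sup p q)"
  shows "covers (inf p q) p"
  unfolding covers_def
proof (intro conjI allI impI)
  have "\<not> p \<le> q" using assms covers_less by (metis sup.absorb2 less_irrefl)
  then show "inf p q < p" by (metis less_le inf.cobounded1 inf.cobounded2)
  fix z assume z: "inf p q \<le> z" "z \<le> p"
  have z_eq: "z = inf (sup z q) p"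
    using modular[OF z(2), of q] z(1) by (simp add: inf_commute sup_absorb1)
  have "sup z q = q \<or> sup z q = sup p q"
    using z(2) by (intro covers_between[OF assms]) (auto intro: le_supI1)
  then show "z = inf p q \<or> z = p"
    using z_eq by (metis inf_commute inf_sup_absorb)
qed

text \<open>
  A longest chain to \<open>b\<close> arrives through some \<open>c\<close> covered by \<open>b\<close>. If \<open>c \<noteq> a\<close>, then both
  cover \<open>a \<sqinter> c\<close>, and by induction both have the rank following that of \<open>a \<sqinter> c\<close>.
\<close>

lemma rank_covers:
  fixes a b :: 'a
  shows "covers a b \<Longrightarrow> rank b = Suc (rank a)"
proof (induction "rank b" arbitrary: a b rule: less_induct)
  case less
  then have "rank a < rank b" using covers_less rank_less by blast
  then obtain n where n: "rank b = Suc n" by (cases "rank b") auto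
  then obtain c where c: "c < b" "rank c = n" by (rule rank_Suc_below)
  show ?case
  proof (cases "c = a")
    case False
    have cb: "covers c b" using c n by (intro covers_if_rank) auto
    have "a \<le> b" using covers_less[OF less.prems] by (rule less_imp_le)
    then have "sup a c = a \<or> sup a c = b" "sup a c = c \<or> sup a c = b"
      using c(1) covers_between[OF less.prems, of "sup a c"] covers_between[OF cb, of "sup a c"] by auto
    then have sup: "sup a c = b" using False by auto
    have "covers (inf a c) a" using cb by (intro covers_inf) (simp add: sup)
    moreover have "covers (inf c a) c" using less.prems sup by (intro covers_inf) (simp add: sup_commute)
    ultimately have "rank a = Suc (rank (inf a c))" "rank c = Suc (rank (inf a c))"
      using less.hyps[of a "inf a c"] less.hyps[of c "inf a c"] \<open>rank a < rank b\<close> c(2) n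
      by (simp_all add: inf_commute)
    then show ?thesis using c n by simp
  qed (use c n in simp)
qed

lemma covers_sup_both:
  fixes y :: 'a
  assumes "covers y a" "covers y b" "a \<noteq> b"
  shows "covers a (sup a b)" "covers b (sup a b)"
  using covers_sup[of a b] covers_sup[of b a] inf_of_covers[OF assms] assms
  by (simp_all add: inf_commute sup_commute)

text \<open>
  If one of three covers of \<open>y\<close> lay below the join of the others, it would have the same
  meet and the same join with one of them as the other has; so three covers span a cube.
\<close>

lemma at_most_two_covers:
  fixes y x1 x2 x3 :: 'a
  assumes y: "covers y x1" "covers y x2" "covers y x3" and ne: "x1 \<noteq> x2" "x1 \<noteq> x3" "x2 \<noteq> x3"
  shows False
proof -
  have not_below: "\<not> c \<le> sup a b"
    if c: "covers y a" "covers y b" "covers y c" "a \<noteq> b" "a \<noteq> c" "b \<noteq> c" for a b c :: 'a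
  proof
    assume "c \<le> sup a b"
    then have "sup a c = a \<or> sup a c = sup a b"
      by (intro covers_between[OF covers_sup_both(1)[OF c(1,2,4)]]) auto
    moreover have "\<not> c \<le> a" using c covers_not_le by metis
    ultimately have "sup a c = sup a b" by (metis sup.cobounded2)
    then have "c = b"
      using inf_of_covers[of y c a] inf_of_covers[of y b a] c
      by (intro cancel[of c a b]) (auto simp: sup_commute)
    with c show False by simp
  qed
  have "inf (sup x1 x2) x3 = y \<or> inf (sup x1 x2) x3 = x3"
    using y[THEN covers_less] by (intro covers_between[OF y(3)]) (auto intro: le_supI1)
  moreover have "inf (sup x1 x2) x3 \<noteq> x3" using not_below[of x1 x2 x3] assms by (metis inf.cobounded1)
  ultimately show False
    using assms not_below[of x1 x2 x3] not_below[of x1 x3 x2] not_below[of x2 x3 x1]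
    by (intro no_cube[of x1 x2 y x3]) (auto intro: inf_of_covers)
qed

text \<open>
  With \<open>x2 = y \<squnion> z\<close>, the joins \<open>x1 \<squnion> x2\<close> and \<open>x3 \<squnion> x2\<close> both cover \<open>x2\<close>. If they differ, \<open>x2\<close>
  is their meet and a grid arises. If they coincide, comparing ranks shows that
  \<open>x1 \<sqinter> x3\<close> is a third cover of \<open>lo\<close> besides \<open>y\<close> and \<open>z\<close>.
\<close>

lemma no_grid_of_covers:
  fixes lo y z x1 x3 :: 'a
  assumes lo: "covers lo y" "covers lo z" "y \<noteq> z"
    and x1: "covers y x1" "x1 \<noteq> sup y z" and x3: "covers z x3" "x3 \<noteq> sup y z"
  shows False
proof -
  define x2 where "x2 = sup y z"
  have x2: "covers y x2" "covers z x2" unfolding x2_def using covers_sup_both[OF lo] .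
  have ne: "x1 \<noteq> x2" "x3 \<noteq> x2" using x1 x3 by (simp_all add: x2_def)
  have inf: "inf x1 x2 = y" "inf x3 x2 = z" using inf_of_covers x1(1) x3(1) x2 ne by blast+
  have u1: "covers x1 (sup x1 x2)" "covers x2 (sup x1 x2)" using covers_sup_both x1(1) x2(1) ne(1) by blast+
  have u3: "covers x3 (sup x3 x2)" "covers x2 (sup x3 x2)" using covers_sup_both x3(1) x2(2) ne(2) by blast+
  have le: "y \<le> x1" "z \<le> x3" "lo \<le> y" "lo \<le> z" using x1 x3 lo covers_less less_imp_le by metis+
  have y_x3: "\<not> y \<le> x3"
  proof
    assume "y \<le> x3"
    then have "x2 \<le> x3" using le by (simp add: x2_def)
    then show False using covers_not_le[OF x2(2) x3(1)] ne by blast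
  qed
  have z_x1: "\<not> z \<le> x1"
  proof
    assume "z \<le> x1"
    then have "x2 \<le> x1" using le by (simp add: x2_def)
    then show False using covers_not_le[OF x2(1) x1(1)] ne by blast
  qed
  have x2_le: "x2 \<le> sup x1 x3" using le by (simp add: x2_def le_supI1 le_supI2)
  show False
  proof (cases "sup x1 x2 = sup x3 x2")
    case True
    have "sup x1 x3 = sup x3 x2"
    proof (rule order.antisym)
      show "sup x1 x3 \<le> sup x3 x2" using True by (metis sup.bounded_iff sup.cobounded1)
      show "sup x3 x2 \<le> sup x1 x3" using x2_le by simp
    qed
    then have "covers (inf x1 x3) x1" using u3(1) by (intro covers_inf) simp
    then have "Suc (rank (inf x1 x3)) = Suc (Suc (rank lo))"
      using rank_covers x1(1) lo(1) by metis
    moreover have "lo \<le> inf x1 x3" using le by auto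
    ultimately have "covers lo (inf x1 x3)" by (intro covers_if_rank) (auto simp: less_le)
    moreover have "inf x1 x3 \<noteq> y" "inf x1 x3 \<noteq> z" using y_x3 z_x1 by (metis inf.cobounded1 inf.cobounded2)+
    ultimately show False using at_most_two_covers lo by metis
  next
    case False
    show False
    proof (rule no_grid)
      show "inf (sup x1 x2) (sup x3 x2) = x2" by (rule inf_of_covers[OF u1(2) u3(2) False])
      show "\<not> sup x1 x2 \<le> sup x3 x2" "\<not> sup x3 x2 \<le> sup x1 x2"
        using covers_not_le[OF u1(2) u3(2)] covers_not_le[OF u3(2) u1(2)] False by auto
    qed (use x2_le inf y_x3 z_x1 in simp_all)
  qed
qed

end

section \<open>Climbing the lattice\<close>

locale always_quadratic_no_cut_edge = always_quadratic L K
  for L :: "'a::{finite,lattice} itself" and K :: "'k::field itself" +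
  assumes no_cut_edge: "\<not> cut_edge (a :: 'a) b"
begin

abbreviation least :: 'a where "least \<equiv> Inf_fin UNIV"

text \<open>
  The first row \<open>a 0, \<dots>, a k\<close> and the second row \<open>a 0 \<squnion> b, \<dots>, a (k - 1) \<squnion> b\<close>, which
  is one rank higher, fill the ranks up to \<open>k\<close>. Since \<open>a 0\<close> is the minimum, \<open>b\<close> itself is the
  first element of the second row.
\<close>

definition ladder :: "nat \<Rightarrow> (nat \<Rightarrow> 'a) \<Rightarrow> 'a \<Rightarrow> bool" where
  "ladder k a b \<longleftrightarrow> a 0 = least \<and> (\<forall>i<k. a i < a (Suc i)) \<and>
    (\<forall>i<k. {x. rank x = Suc i} = {a (Suc i), sup (a i) b}) \<and> \<not> b \<le> a k"

text \<open>
  The second row cannot branch off: only the next element of that row covers its last one.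
\<close>

definition closed_side :: "nat \<Rightarrow> (nat \<Rightarrow> 'a) \<Rightarrow> 'a \<Rightarrow> bool" where
  "closed_side k a b \<longleftrightarrow>
    (\<forall>s. rank s = Suc (Suc k) \<longrightarrow> sup (a k) b < s \<longrightarrow> s = sup (a (Suc k)) b)"

lemma ladderD:
  assumes "ladder k a b"
  shows ladder_0: "a 0 = least"
    and ladder_less: "i < k \<Longrightarrow> a i < a (Suc i)"
    and ladder_level: "i < k \<Longrightarrow> {x. rank x = Suc i} = {a (Suc i), sup (a i) b}"
    and ladder_not_below: "\<not> b \<le> a k"
  using assms unfolding ladder_def by blast+

lemma ladder_rank:
  assumes "ladder k a b" "i \<le> k"
  shows "rank (a i) = i"
proof (cases i)
  case 0
  then show ?thesis using ladder_0[OF assms(1)] by (simp add: rank_eq_0_iff)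
next
  case (Suc j)
  then have "a i \<in> {x. rank x = Suc j}" using ladder_level[OF assms(1), of j] assms(2) by simp
  then show ?thesis using Suc by simp
qed

lemma covers_of_rank_Suc:
  assumes "rank (s :: 'a) = Suc n"
  obtains c where "rank c = n" "covers c s"
  using rank_Suc_below[OF assms] covers_if_rank assms by metis

text \<open>
  With \<open>p\<close> and \<open>q\<close> the elements of rank \<open>Suc k\<close> and \<open>j\<close> their join, the exclusion of stacked
  squares leaves \<open>j\<close> at most one cover, and the closed side of \<open>q\<close> leaves \<open>p\<close> as the only
  element that other elements of the next rank can cover. If there were none besides \<open>j\<close>, then
  \<open>j\<close>, which is not the maximum, and its cover would be a cut edge.
\<close>

lemma ladder_extend:
  assumes ladder: "ladder (Suc k) a b" and closed: "closed_side k a b"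
    and not_top: "\<not> x \<le> sup (a (Suc k)) b"
  obtains s where "ladder (Suc (Suc k)) (a(Suc (Suc k) := s)) b"
    "closed_side (Suc k) (a(Suc (Suc k) := s)) b"
proof -
  define p q j where "p = a (Suc k)" and "q = sup (a k) b" and "j = sup p q"
  have "a k < p" "\<not> b \<le> p" and level: "{x. rank x = Suc k} = {p, q}"
    unfolding p_def q_def
    using ladder_less[OF ladder, of k] ladder_not_below[OF ladder] ladder_level[OF ladder, of k] by simp_all
  have "p \<in> {x. rank x = Suc k}" "q \<in> {x. rank x = Suc k}" unfolding level by simp_all
  then have rank_pq: "rank p = Suc k" "rank q = Suc k" by simp_all
  have j_eq: "j = sup p b" using \<open>a k < p\<close> unfolding j_def q_def
    by (simp add: sup_assoc[symmetric] sup_absorb1)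
  have "\<not> q \<le> p" using \<open>\<not> b \<le> p\<close> by (auto simp: q_def)
  then have "p \<noteq> q" "\<not> p \<le> q" using eq_if_le_rank_eq[of p q] rank_pq by auto
  have rank_ak: "rank (a k) = k" using ladder by (rule ladder_rank) simp
  have "covers (a k) p" using \<open>a k < p\<close> rank_ak rank_pq by (intro covers_if_rank) auto
  moreover have "a k < q" using rank_ak rank_pq unfolding q_def by (auto simp: less_le)
  then have "covers (a k) q" using rank_ak rank_pq by (intro covers_if_rank) auto
  ultimately have j: "covers p j" "covers q j"
    unfolding j_def using covers_sup_both \<open>p \<noteq> q\<close> by blast+
  then have rank_j: "rank j = Suc (Suc k)" using rank_covers rank_pq by metis
  have above_j: "t = t'" if "covers j t" "covers j t'" for t t'
  proof (rule ccontr)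
    assume "t \<noteq> t'"
    then have "inf t t' = sup p q" using inf_of_covers that by (simp add: j_def)
    then show False
      using \<open>t \<noteq> t'\<close> \<open>\<not> q \<le> p\<close> \<open>\<not> p \<le> q\<close> that covers_not_le[of j t t'] covers_not_le[of j t' t]
      by (intro no_stacked_squares[of p q t t']) auto
  qed
  have above_p: "covers p s" if "rank s = Suc (Suc k)" "s \<noteq> j" for s
  proof -
    obtain c where c: "rank c = Suc k" "covers c s" using \<open>rank s = _\<close> by (rule covers_of_rank_Suc)
    then have "c \<in> {p, q}" unfolding level[symmetric] by simp
    moreover have "c \<noteq> q"
    proof
      assume "c = q"
      then have "q < s" using c covers_less by blast
      then have "s = sup (a (Suc k)) b"
        using closed \<open>rank s = _\<close> unfolding closed_side_def q_def by blast
      then show False using \<open>s \<noteq> j\<close> j_eq p_def by simp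
    qed
    ultimately show ?thesis using c by simp
  qed
  have "\<not> x \<le> j" using not_top j_eq p_def by simp
  then have "j < sup x j" by (simp add: less_le_not_le)
  then obtain t where t: "covers j t" by (rule exists_cover)
  \<comment> \<open>Otherwise \<open>j\<close> is alone in its rank, and all elements of the next rank cover it.\<close>
  have "\<exists>s. rank s = Suc (Suc k) \<and> s \<noteq> j"
  proof (rule ccontr)
    assume none: "\<not> ?thesis"
    have only_j: "s = j" if "rank s = rank j" for s
      using none that rank_j by metis
    have only_t: "s = t" if "rank s = rank t" for s
    proof -
      have "rank s = Suc (rank j)" using that rank_covers[OF t] by simp
      then obtain c where "rank c = rank j" "covers c s" by (rule covers_of_rank_Suc)
      then have "covers j s" using only_j by metis
      then show "s = t" using t by (rule above_j)
    qed
    have "{s. rank s = rank j} = {j}" "{s. rank s = rank t} = {t}"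
      using only_j only_t by blast+
    then have "cut_edge j t" unfolding cut_edge_def using rank_covers[OF t] by simp
    then show False using no_cut_edge by blast
  qed
  then obtain s where s: "rank s = Suc (Suc k)" "s \<noteq> j" by blast
  have "covers p s" using above_p s by blast
  have "p < s" using \<open>covers p s\<close> by (rule covers_less)
  have "\<not> j \<le> s" using eq_if_le_rank_eq[of j s] s rank_j by auto
  then have "\<not> b \<le> s" using \<open>p < s\<close> j_eq by auto
  have level': "{x. rank x = Suc (Suc k)} = {s, j}"
  proof (intro set_eqI iffI)
    fix e :: 'a assume "e \<in> {x. rank x = Suc (Suc k)}"
    then show "e \<in> {s, j}"
      using at_most_two_covers[OF j(1) \<open>covers p s\<close>, of e] above_p[of e] s(2) by auto
  qed (use s rank_j in auto)
  show thesis
  proof (rule that)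
    let ?a = "a(Suc (Suc k) := s)"
    have "?a i < ?a (Suc i)" if "i < Suc (Suc k)" for i
      using that ladder_less[OF ladder, of i] \<open>p < s\<close> unfolding p_def by (cases "i = Suc k") auto
    moreover have "{x. rank x = Suc i} = {?a (Suc i), sup (?a i) b}" if "i < Suc (Suc k)" for i
      using that ladder_level[OF ladder, of i] level' unfolding j_eq p_def by (cases "i = Suc k") auto
    moreover have "?a 0 = least" "\<not> b \<le> ?a (Suc (Suc k))"
      using ladder_0[OF ladder] \<open>\<not> b \<le> s\<close> by simp_all
    ultimately show "ladder (Suc (Suc k)) ?a b" unfolding ladder_def by blast
    show "closed_side (Suc k) ?a b"
      unfolding closed_side_def
    proof (intro allI impI)
      fix t' assume t': "rank t' = Suc (Suc (Suc k))" "sup (?a (Suc k)) b < t'"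
      then have "j < t'" by (simp add: j_eq p_def)
      then have "covers j t'" using t' rank_j by (intro covers_if_rank) auto
      have "covers j (sup s j)"
        using covers_sup_both[OF \<open>covers p s\<close> j(1) s(2)] by simp
      moreover have "sup s j = sup s b"
        using \<open>p < s\<close> unfolding j_eq by (simp add: sup_assoc[symmetric] sup_absorb1)
      ultimately show "t' = sup (?a (Suc (Suc k))) b" using above_j \<open>covers j t'\<close> by simp
    qed
  qed
qed

text \<open>
  A single atom would form a cut edge with the minimum, so there are two. By the exclusion of
  grids, one of them is covered by their join alone, and it becomes \<open>b\<close>.
\<close>

lemma ladder_start:
  assumes "(x :: 'a) \<noteq> y"
  obtains a b where "ladder (Suc 0) a b" "closed_side 0 a b"
proof -
  note result = that
  have "\<exists>x'. least < x'" using assms least_le[of x] least_le[of y] by (metis le_less)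
  then obtain t where t: "covers least t" using exists_cover by metis
  have rank_least: "rank least = 0" by (simp add: rank_eq_0_iff)
  have atoms: "covers least s \<longleftrightarrow> rank s = Suc 0" for s
    using rank_covers[of least s] covers_of_rank_Suc[of s 0] rank_eq_0_iff rank_least by metis
  have "{s. rank s = rank t} \<noteq> {t}"
  proof
    assume "{s. rank s = rank t} = {t}"
    moreover have "{s. rank s = rank least} = {least}" using rank_least rank_eq_0_iff by auto
    ultimately have "cut_edge least t" unfolding cut_edge_def using rank_covers[OF t] by simp
    then show False using no_cut_edge by blast
  qed
  then obtain t' where t': "covers least t'" "t' \<noteq> t" using atoms t by force
  then have level: "{s. rank s = Suc 0} = {t, t'}"
    using at_most_two_covers t unfolding atoms[symmetric] by blast
  have start: thesis
    if bc: "{c, b} = {t, t'}" "c \<noteq> b" and only: "\<And>s. covers b s \<Longrightarrow> s = sup c b" for b c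
  proof (rule result)
    let ?a = "\<lambda>i :: nat. if i = 0 then least else c"
    have cov: "covers least b" "covers least c" using bc t t' by (auto simp: doubleton_eq_iff)
    then have "\<not> b \<le> c" using covers_not_le bc by metis
    moreover have "sup least b = b" by (simp add: least_le sup_absorb2)
    ultimately show "ladder (Suc 0) ?a b"
      unfolding ladder_def using level bc(1) covers_less[OF cov(2)] by simp
    show "closed_side 0 ?a b"
      unfolding closed_side_def
    proof (intro allI impI)
      fix s assume s: "rank s = Suc (Suc 0)" "sup (?a 0) b < s"
      then have "covers b s"
        using cov(1) \<open>sup least b = b\<close> unfolding atoms by (intro covers_if_rank) auto
      then show "s = sup (?a (Suc 0)) b" using only by simp
    qed
  qed
  show thesis
  proof (cases "\<forall>s. covers t s \<longrightarrow> s = sup t' t")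
    case True
    then show thesis using t' by (intro start[of t' t]) auto
  next
    case False
    then have "s = sup t t'" if "covers t' s" for s
      using no_grid_of_covers[OF t t'(1)] t'(2) that by (metis sup_commute)
    then show thesis using t' by (intro start[of t t']) auto
  qed
qed

text \<open>
  Ranks are bounded, so some ladder is of maximal length; as it cannot be extended, all elements
  lie below its last rung.
\<close>

lemma full_ladder:
  assumes "(x :: 'a) \<noteq> y"
  obtains k a b where "k \<ge> 1" "ladder k a b" "\<And>x. x \<le> sup (a k) b"
proof -
  let ?P = "\<lambda>k. \<exists>a b. ladder (Suc k) a b \<and> closed_side k a b"
  have bound: "k \<le> Max (range (rank :: 'a \<Rightarrow> nat))" if P: "?P k" for k
  proof -
    from P obtain a b where "ladder (Suc k) a b" by blast
    then have "rank (a (Suc k)) = Suc k" by (rule ladder_rank) simp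
    moreover have "rank (a (Suc k)) \<le> Max (range (rank :: 'a \<Rightarrow> nat))" by simp
    ultimately show ?thesis by simp
  qed
  have "?P 0" using ladder_start[OF assms] by metis
  then obtain k where "?P k" and max: "\<And>k'. ?P k' \<Longrightarrow> k' \<le> k"
    using Nat.ex_has_greatest_nat[of ?P 0 "Max (range (rank :: 'a \<Rightarrow> nat))"] bound by metis
  then obtain a b where ab: "ladder (Suc k) a b" "closed_side k a b" by blast
  have "x \<le> sup (a (Suc k)) b" for x
  proof (rule ccontr)
    assume "\<not> ?thesis"
    from ladder_extend[OF ab this] have "?P (Suc k)" by metis
    then show False using max[of "Suc k"] by simp
  qed
  then show thesis using ab(1) by (intro that[of "Suc k" a b]) auto
qed

end

section \<open>Divisors of twice a power of three\<close>

lemma gcd_pow3: "gcd ((3::nat) ^ i) (3 ^ j) = 3 ^ min i j"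
  by (cases "i \<le> j") (auto simp: min_def le_imp_power_dvd gcd_nat.absorb1 gcd_nat.absorb2)

lemma gcd_pow3_double: "gcd ((3::nat) ^ i) (2 * 3 ^ j) = 3 ^ min i j"
  using gcd_mult_right_left_cancel[of "3 ^ i" "2::nat"] by (simp add: gcd_pow3)

lemma lcm_pow3_double: "lcm ((3::nat) ^ i) (2 * 3 ^ j) = 2 * 3 ^ max i j"
proof -
  have "3 ^ min i j * lcm ((3::nat) ^ i) (2 * 3 ^ j) = 3 ^ i * (2 * 3 ^ j)"
    using prod_gcd_lcm_nat[of "3 ^ i" "2 * 3 ^ j"] by (simp add: gcd_pow3_double)
  also have "\<dots> = 3 ^ min i j * (2 * 3 ^ max i j)"
    by (cases "i \<le> j") (simp_all add: min_def max_def)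
  finally show ?thesis by simp
qed

lemma pow3_neq_double: "(3::nat) ^ i \<noteq> 2 * 3 ^ j"
  by (metis dvd_triv_left even_numeral even_power numeral_eq_iff odd_numeral)

lemma dvd_double_pow3_iff:
  "(d::nat) dvd 2 * 3 ^ r \<longleftrightarrow> (\<exists>i\<le>r. d = 3 ^ i) \<or> (\<exists>i\<le>r. d = 2 * 3 ^ i)"
proof
  assume "d dvd 2 * 3 ^ r"
  then obtain c e where "d = c * e" "c dvd 2" "e dvd 3 ^ r" by (rule dvd_productE)
  moreover have "c = 1 \<or> c = 2" using \<open>c dvd 2\<close> two_is_prime_nat unfolding prime_nat_iff by blast
  moreover obtain i where "i \<le> r" "e = 3 ^ i"
    using \<open>e dvd 3 ^ r\<close> divides_primepow_nat[of 3] by auto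
  ultimately show "(\<exists>i\<le>r. d = 3 ^ i) \<or> (\<exists>i\<le>r. d = 2 * 3 ^ i)" by auto
qed (auto intro: le_imp_power_dvd dvd_mult)

text \<open>
  The rows are the powers of 3 and their doubles.
\<close>

lemma iso_divisor_lattice_two_row:
  fixes L :: "'a::{finite,lattice} itself"
  assumes "iso_divisor_lattice L (2 * 3 ^ r)"
  obtains p q :: "nat \<Rightarrow> 'a" where "two_row_lattice r p q"
proof -
  obtain f :: "'a \<Rightarrow> nat" where f: "bij_betw f UNIV {d. d dvd 2 * 3 ^ r}"
    and f_inf: "\<And>a b. f (inf a b) = gcd (f a) (f b)" and f_sup: "\<And>a b. f (sup a b) = lcm (f a) (f b)"
    using assms unfolding iso_divisor_lattice_def by blast
  have inj: "f a = f b \<longleftrightarrow> a = b" for a b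
    using f by (auto simp: bij_betw_def inj_eq)
  define p where "p i = inv f (3 ^ i)" for i
  define q where "q i = inv f (2 * 3 ^ i)" for i
  have f_inv: "f (inv f d) = d" if "d dvd 2 * 3 ^ r" for d
    using f that by (intro f_inv_into_f) (auto simp: bij_betw_def)
  have fp: "f (p i) = 3 ^ i" and fq: "f (q i) = 2 * 3 ^ i" if "i \<le> r" for i
    unfolding p_def q_def using that by (auto intro!: f_inv simp: dvd_double_pow3_iff)
  have le_iff: "a \<le> b \<longleftrightarrow> f a dvd f b" for a b
    by (metis f_inf gcd_nat.order_iff inf.order_iff inj)
  have "two_row_lattice r p q"
  proof
    fix x
    have "f x dvd 2 * 3 ^ r" using f by (auto simp: bij_betw_def)
    then have "(\<exists>i\<le>r. f x = f (p i)) \<or> (\<exists>i\<le>r. f x = f (q i))"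
      by (auto simp: dvd_double_pow3_iff fp fq)
    then show "(\<exists>i\<le>r. x = p i) \<or> (\<exists>i\<le>r. x = q i)" by (simp add: inj)
  next
    show "inj_on p {..r}"
      by (rule inj_onI) (metis atMost_iff fp power_inject_exp numeral_less_iff one_less_numeral_iff semiring_norm(77))
    show "inj_on q {..r}"
      by (rule inj_onI)
        (metis atMost_iff fq mult_cancel1 power_inject_exp numeral_less_iff one_less_numeral_iff
          semiring_norm(77) zero_neq_numeral)
  next
    fix i j assume ij: "i \<le> r" "j \<le> r"
    show "p i \<noteq> q j" using pow3_neq_double fp fq ij by metis
    have "f (inf (p i) (q j)) = f (p (min i j))"
      using ij by (simp add: f_inf fp fq gcd_pow3_double)
    then show "inf (p i) (q j) = p (min i j)" by (simp only: inj)
    have "f (sup (p i) (q j)) = f (q (max i j))"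
      using ij by (simp add: f_sup fp fq lcm_pow3_double)
    then show "sup (p i) (q j) = q (max i j)" by (simp only: inj)
  next
    fix i j assume ij: "i \<le> j" "j \<le> r"
    then show "p i \<le> p j" "q i \<le> q j" by (simp_all add: le_iff fp fq le_imp_power_dvd)
  qed
  then show thesis by (rule that)
qed

lemma (in two_row_lattice) iso_divisor_lattice: "iso_divisor_lattice TYPE('a) (2 * 3 ^ r)"
proof -
  define f :: "'a \<Rightarrow> nat" where
    "f x = (if x \<in> p ` {..r} then 3 ^ inv_into {..r} p x else 2 * 3 ^ inv_into {..r} q x)" for x
  have fp: "f (p i) = 3 ^ i" if "i \<le> r" for i
    using that inj_p by (simp add: f_def)
  have fq: "f (q i) = 2 * 3 ^ i" if "i \<le> r" for i
  proof -
    have "q i \<notin> p ` {..r}" using p_neq_q that by (metis atMost_iff imageE)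
    then show ?thesis using that inj_q by (simp add: f_def)
  qed
  have elem: "(\<exists>i\<le>r. x = p i) \<or> (\<exists>i\<le>r. x = q i)" for x by (rule cover)
  have "inj f"
  proof (rule injI)
    fix x y assume eq: "f x = f y"
    consider i j where "i \<le> r" "j \<le> r" "x = p i" "y = p j" | i j where "i \<le> r" "j \<le> r" "x = q i" "y = q j"
      | i j where "i \<le> r" "j \<le> r" "x = p i" "y = q j" | i j where "i \<le> r" "j \<le> r" "x = q i" "y = p j"
      using elem[of x] elem[of y] by metis
    then show "x = y"
      using eq pow3_neq_double pow3_neq_double[symmetric] by cases (simp_all add: fp fq)
  qed
  moreover have "range f = {d. d dvd 2 * 3 ^ r}"
  proof (intro set_eqI iffI)
    fix d :: nat assume "d \<in> range f"
    then obtain x where "d = f x" by blast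
    then show "d \<in> {d. d dvd 2 * 3 ^ r}"
      using elem[of x] unfolding mem_Collect_eq dvd_double_pow3_iff by (metis fp fq)
  next
    fix d :: nat assume "d \<in> {d. d dvd 2 * 3 ^ r}"
    then show "d \<in> range f" unfolding dvd_double_pow3_iff mem_Collect_eq by (metis fp fq rangeI)
  qed
  moreover have "f (inf x y) = gcd (f x) (f y) \<and> f (sup x y) = lcm (f x) (f y)" for x y
  proof -
    have pq: "f (inf (p i) (q j)) = gcd (f (p i)) (f (q j)) \<and> f (sup (p i) (q j)) = lcm (f (p i)) (f (q j))"
      if "i \<le> r" "j \<le> r" for i j
      using that by (simp add: inf_pq sup_pq fp fq gcd_pow3_double lcm_pow3_double)
    have comparable: ?thesis if "x \<le> y \<and> f x dvd f y \<or> y \<le> x \<and> f y dvd f x"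
      using that by (auto simp: inf_absorb1 inf_absorb2 sup_absorb1 sup_absorb2)
    consider i j where "i \<le> r" "j \<le> r" "x = p i" "y = p j" | i j where "i \<le> r" "j \<le> r" "x = q i" "y = q j"
      | i j where "i \<le> r" "j \<le> r" "x = p i" "y = q j" | i j where "i \<le> r" "j \<le> r" "x = q i" "y = p j"
      using elem[of x] elem[of y] by metis
    then show ?thesis
    proof cases
      case (1 i j)
      then have "x \<le> y \<and> f x dvd f y \<or> y \<le> x \<and> f y dvd f x"
        using p_mono[of i j] p_mono[of j i] by (cases "i \<le> j") (simp_all add: fp le_imp_power_dvd)
      then show ?thesis by (rule comparable)
    next
      case (2 i j)
      then have "x \<le> y \<and> f x dvd f y \<or> y \<le> x \<and> f y dvd f x"
        using q_mono[of i j] q_mono[of j i] by (cases "i \<le> j") (simp_all add: fq le_imp_power_dvd)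
      then show ?thesis by (rule comparable)
    next
      case (3 i j)
      then show ?thesis using pq by simp
    next
      case (4 i j)
      then show ?thesis using pq[of j i] by (simp add: inf_commute sup_commute gcd.commute lcm.commute)
    qed
  qed
  ultimately show ?thesis unfolding iso_divisor_lattice_def bij_betw_def by blast
qed

context always_quadratic_no_cut_edge
begin

text \<open>
  The meets across the rows come from modularity: if \<open>a j \<le> a i\<close>, then
  \<open>a i \<sqinter> (a j \<squnion> b) = a j \<squnion> (b \<sqinter> a i)\<close>, and \<open>b \<sqinter> a i\<close> is the minimum because \<open>b\<close> is an atom not
  below \<open>a i\<close>.
\<close>

lemma full_ladder_two_row_lattice:
  assumes ladder: "ladder k a b" and top: "\<And>x. x \<le> sup (a k) b" and "k \<ge> 1"
  shows "two_row_lattice k a (\<lambda>i. sup (a i) b)"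
proof -
  have a_mono: "a i \<le> a j" if "i \<le> j" "j \<le> k" for i j
    using that
  proof (induction j)
    case (Suc j)
    then show ?case using ladder_less[OF ladder, of j] by (cases "i = Suc j") auto
  qed simp
  have b_not_le: "\<not> b \<le> a i" if "i \<le> k" for i
    using ladder_not_below[OF ladder] a_mono[OF that order.refl] order.trans by blast
  have "b \<in> {x. rank x = Suc 0}"
    using ladder_level[OF ladder, of 0] ladder_0[OF ladder] \<open>k \<ge> 1\<close> least_le[of b] by (simp add: sup_absorb2)
  then obtain c where "rank c = 0" "covers c b" by (auto elim: covers_of_rank_Suc)
  then have b_atom: "covers least b" by (simp add: rank_eq_0_iff)
  have inf_b: "inf b (a i) = least" if "i \<le> k" for i
  proof -
    have "inf b (a i) \<noteq> b" using b_not_le[OF that] by (simp add: inf.absorb_iff1)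
    then show ?thesis using covers_between[OF b_atom least_le inf.cobounded1] by blast
  qed
  have rank_b: "rank (sup (a i) b) = Suc i" if "i \<le> k" for i
  proof -
    have "covers (a i) (sup b (a i))" using b_atom inf_b[OF that] by (intro covers_sup) simp
    from rank_covers[OF this] show ?thesis using ladder_rank[OF ladder that] by (simp add: sup_commute)
  qed
  show ?thesis
  proof
    fix x :: 'a
    have "rank x \<le> Suc k"
      using rank_b[of k] top[of x] rank_less[of x "sup (a k) b"] by (auto simp: le_less)
    then consider "rank x = 0" | i where "i < k" "rank x = Suc i" | "rank x = Suc k"
      by (cases "rank x") (auto simp: le_less)
    then show "(\<exists>i\<le>k. x = a i) \<or> (\<exists>i\<le>k. x = sup (a i) b)"
    proof cases
      case 1
      then show ?thesis using ladder_0[OF ladder] by (auto simp: rank_eq_0_iff)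
    next
      case 2
      then have "x \<in> {a (Suc i), sup (a i) b}" using ladder_level[OF ladder, of i] by blast
      then show ?thesis using \<open>i < k\<close> by (auto intro: exI[of _ "Suc i"] exI[of _ i])
    next
      case 3
      then have "x = sup (a k) b" using rank_b[of k] top by (intro eq_if_le_rank_eq) auto
      then show ?thesis by blast
    qed
  next
    show "inj_on a {..k}" by (rule inj_on_inverseI[of _ rank]) (simp add: ladder_rank[OF ladder])
    show "inj_on (\<lambda>i. sup (a i) b) {..k}" by (rule inj_on_inverseI[of _ "\<lambda>x. rank x - 1"]) (simp add: rank_b)
  next
    fix i j assume ij: "i \<le> k" "j \<le> k"
    show "a i \<noteq> sup (a j) b" using b_not_le[OF ij(1)] by (metis sup.cobounded2)
    show "inf (a i) (sup (a j) b) = a (min i j)"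
    proof (cases "i \<le> j")
      case True
      then show ?thesis using a_mono[of i j] ij by (simp add: inf_absorb1 le_supI1 min_def)
    next
      case False
      then have "a j \<le> a i" using a_mono ij by simp
      from modular[OF this, of b] have "inf (a i) (sup (a j) b) = sup (a j) (inf b (a i))"
        by (simp add: inf_commute)
      also have "\<dots> = a j" using inf_b[OF ij(1)] by (simp add: sup_absorb1 least_le)
      finally show ?thesis using False by (simp add: min_def)
    qed
    show "sup (a i) (sup (a j) b) = sup (a (max i j)) b"
      using a_mono[of i j] a_mono[of j i] ij
      by (cases "i \<le> j") (simp_all add: sup_assoc[symmetric] sup_absorb1 sup_absorb2 max_def)
  next
    fix i j assume "i \<le> j" "j \<le> k"
    then show "a i \<le> a j" "sup (a i) b \<le> sup (a j) b" using a_mono[of i j] by (auto intro: le_supI1)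
  qed
qed

end

text \<open>
  As Groebner bases belong to nonzero ideals, this excludes the one-element lattice.
\<close>

lemma join_meet_ideal_trivial:
  assumes "\<And>x y :: 'a::{finite,lattice}. x = y"
  shows "(join_meet_ideal :: ('a, 'k::field) mpoly set) = {0}"
proof -
  have "inf a b = a" "sup a b = b" for a b :: 'a by (rule assms)+
  then have "{basic_binomial a b :: ('a, 'k) mpoly | a b. True} = {0}"
    by (auto simp: basic_binomial_def)
  then show ?thesis
    unfolding join_meet_ideal_def ideal_gen_def
    by (metis ring_module.span_eq_iff ring_module.subspace_single_0)
qed

theorem theorem2p2:
  assumes "pure_lattice TYPE('a::{finite,lattice})"
    and "\<not> (\<exists>a b :: 'a. cut_edge a b)"
  shows "(\<exists>r\<ge>1. iso_divisor_lattice TYPE('a) (2 * 3 ^ r)) \<longleftrightarrow>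
    (\<forall>lt. monomial_order lt \<longrightarrow>
      (\<exists>G. quadratic_groebner_basis lt G (join_meet_ideal :: ('a, 'k::field) mpoly set)))"
proof
  assume "\<exists>r\<ge>1. iso_divisor_lattice TYPE('a) (2 * 3 ^ r)"
  then obtain r where "r \<ge> 1" "iso_divisor_lattice TYPE('a) (2 * 3 ^ r)" by blast
  then obtain p q :: "nat \<Rightarrow> 'a" where "two_row_lattice r p q"
    using iso_divisor_lattice_two_row by metis
  then show "\<forall>lt. monomial_order lt \<longrightarrow>
      (\<exists>G. quadratic_groebner_basis lt G (join_meet_ideal :: ('a, 'k) mpoly set))"
    using two_row_lattice.quadratic_groebner_basis_minors \<open>r \<ge> 1\<close> by blast
next
  assume quadratic: "\<forall>lt. monomial_order lt \<longrightarrow>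
      (\<exists>G. quadratic_groebner_basis lt G (join_meet_ideal :: ('a, 'k) mpoly set))"
  have "\<exists>x y :: 'a. x \<noteq> y"
  proof (rule ccontr)
    assume "\<not> ?thesis"
    then have "(join_meet_ideal :: ('a, 'k) mpoly set) = {0}" by (intro join_meet_ideal_trivial) blast
    moreover obtain lt :: "'a monomial \<Rightarrow> 'a monomial \<Rightarrow> bool" where "monomial_order lt"
      by (rule weight_refining_order[of "\<lambda>_. 0"])
    ultimately show False
      using quadratic unfolding quadratic_groebner_basis_def groebner_basis_def by blast
  qed
  then obtain x y :: 'a where "x \<noteq> y" by blast
  interpret always_quadratic_no_cut_edge "TYPE('a)" "TYPE('k)"
    using quadratic assms(2) by unfold_locales (auto simp: quadratic_for_all_orders_def)
  obtain k a and b :: 'a where "k \<ge> 1" "ladder k a b" "\<And>x. x \<le> sup (a k) b"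
    using full_ladder[OF \<open>x \<noteq> y\<close>] by blast
  then have "two_row_lattice k a (\<lambda>i. sup (a i) b)" by (intro full_ladder_two_row_lattice)
  then have "iso_divisor_lattice TYPE('a) (2 * 3 ^ k)" by (rule two_row_lattice.iso_divisor_lattice)
  with \<open>k \<ge> 1\<close> show "\<exists>r\<ge>1. iso_divisor_lattice TYPE('a) (2 * 3 ^ r)" by blast
qed

end
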